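(* Let $n\ge 1$, let $m$ be a non-negative integer, let $\alpha>0$, let $0<p\leq q<\infty$, and let $\mu\geq 0$ be a positive Borel measure on $\mathbb{C}^n$. Then the following statements are equivalent. (i) $\mu$ is a $(p,q)$ Fock--Carleson measure for the Fock--Sobolev spaces of order $m$; (ii) $\widetilde{\mu}_{(t,mq)}\in L^\infty$ for some (or any) $t>0$; (iii) $\mu_{(mq,r,D)}\in L^\infty$ for some (or any) $r>0$; (iv) $\big(\mu_{(mq,r,D)}(z_k)\big)_{k}\in \ell^\infty$ for some (or any) $r>0$. Moreover, $$\|\mu\|^q\simeq \|\widetilde{\mu}_{(t,mq)}\|_{L^\infty}\simeq \|\mu_{(mq,r,D)}\|_{L^\infty}\simeq \|\mu_{(mq,r,D)}(z_k)\|_{\ell^\infty}.$$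
   Context: $dV$ is Lebesgue measure on $\mathbb{C}^n$, $\langle z,w\rangle=\sum_j z_j\overline{w_j}$, $|z|=\sqrt{\langle z,z\rangle}$, $L^p=L^p(\mathbb{C}^n,dV)$. For $0<p<\infty$ put $\|f\|_p^p=(\frac{\alpha p}{2\pi})^n\int_{\mathbb{C}^n}|f(z)|^pe^{-\frac{\alpha p}{2}|z|^2}dV(z)$, and $\|f\|_\infty=\sup_z|f(z)|e^{-\frac{\alpha}{2}|z|^2}$. The Fock--Sobolev space $\mathcal{F}^p_{(m,\alpha)}$ ($0<p\le\infty$) of order $m$ consists of the entire functions $f$ on $\mathbb{C}^n$ with $\sum_{\beta_1+\dots+\beta_n\le m}\|\partial^\beta f\|_p<\infty$. It is equipped throughout with the equivalent (quasi-)norm $\|f\|_{(p,m)}=\big(C_{(p,m,n)}\int_{\mathbb{C}^n}|z|^{mp}|f(z)|^pe^{-\frac{\alpha p}{2}|z|^2}dV(z)\big)^{1/p}$ for $p<\infty$, where $C_{(p,m,n)}=(\frac{\alpha p}{2})^{\frac{mp}{2}+n}\frac{\Gamma(n)}{\pi^n\Gamma(\frac{mp}{2}+n)}$, and $\|f\|_{(\infty,m)}=\sup_z|z|^m|f(z)|e^{-\frac{\alpha}{2}|z|^2}$ for $p=\infty$. For $0<p\le\infty$, $0<q<\infty$, $\mu$ is a $(p,q)$ Fock--Carleson measure if there is a constant $C$ with $\int_{\mathbb{C}^n}|f(z)|^qe^{-\frac{\alpha q}{2}|z|^2}d\mu(z)\le C^q\|f\|_{(p,m)}^q$ for all $f\in\mathcal{F}^p_{(m,\alpha)}$,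 i.e. the embedding $I_\mu:\mathcal{F}^p_{(m,\alpha)}\to L^q(\sigma_q)$, $d\sigma_q(z)=e^{-\frac{q\alpha}{2}|z|^2}d\mu(z)$, is bounded; $\|\mu\|=\|I_\mu\|$ is the smallest such $C$. For $t>0$, $s\ge 0$, the $(t,s)$-Berezin type transform is $\widetilde{\mu}_{(t,s)}(w)=\int_{\mathbb{C}^n}(1+|z|)^{-s}e^{-\frac{t\alpha}{2}|z-w|^2}d\mu(z)$. With $D(z,r)=\{w\in\mathbb{C}^n:|z-w|<r\}$, put $\mu_{(s,r,D)}(z)=\mu(D(z,r))/(1+|z|)^s$. A sequence of distinct points $(z_k)_{k\in\mathbb{N}}$ is an $r/2$-lattice for $\mathbb{C}^n$ if the balls $D(z_k,r)$ cover $\mathbb{C}^n$ and the balls $D(z_k,r/2)$ are mutually disjoint. In conditions involving $(z_k)$ and $r$, $(z_k)$ is an $r/2$-lattice for that $r$. "For some (or any)" means that the condition for one value of the parameter is equivalent to the condition for every value. $U\simeq V$ means $U\le CV$ and $V\le CU$ with a constant $C$ independent of $\mu$. *)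

theory Defs
  imports "HOL-Probability.Essential_Supremum"
begin

text \<open>
  \<open>\<complex>\<^sup>n\<close> is the type \<^typ>\<open>complex ^ 'n\<close>, so \<open>n = CARD('n) \<ge> 1\<close>; its \<^const>\<open>norm\<close> is the
  Hermitian norm and \<^const>\<open>lborel\<close> is Lebesgue measure.  Norms and integrals take values in
  \<open>[0,\<infinity>]\<close>, i.e. in \<^typ>\<open>ennreal\<close>.
\<close>

text \<open>\<open>x\<^sup>a\<close> on \<open>[0,\<infinity>]\<close>, meant for exponents \<open>a > 0\<close> (so that \<open>\<infinity>\<^sup>a = \<infinity>\<close> and \<open>0\<^sup>a = 0\<close>).\<close>
definition enn_powr :: "ennreal \<Rightarrow> real \<Rightarrow> ennreal" where
  "enn_powr x a = (if x = top then top else ennreal (enn2real x powr a))"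

text \<open>Holomorphy on all of \<open>\<complex>\<^sup>n\<close>: a complex-linear derivative exists at every point.\<close>
definition entire :: "(complex ^ 'n \<Rightarrow> complex) \<Rightarrow> bool" where
  "entire f \<longleftrightarrow>
     (\<forall>z. \<exists>D. (f has_derivative D) (at z) \<and> (\<forall>c v. D (c *s v) = c * D v))"

definition partial_deriv :: "'n \<Rightarrow> (complex ^ 'n \<Rightarrow> complex) \<Rightarrow> complex ^ 'n \<Rightarrow> complex" where
  "partial_deriv j f z = deriv (\<lambda>\<zeta>. f (\<chi> i. if i = j then \<zeta> else z $ i)) (z $ j)"

text \<open>
  \<open>\<partial>\<^sup>\<beta> f\<close>.  The index type carries no order, so an arbitrary enumeration of the variables is
  chosen; on entire functions partial derivatives commute and the choice is immaterial.
\<close>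
definition multi_deriv ::
    "('n::finite \<Rightarrow> nat) \<Rightarrow> (complex ^ 'n \<Rightarrow> complex) \<Rightarrow> complex ^ 'n \<Rightarrow> complex" where
  "multi_deriv \<beta> f =
     foldr (\<lambda>j. partial_deriv j ^^ \<beta> j) (SOME js. distinct js \<and> set js = UNIV) f"

definition fock_norm :: "real \<Rightarrow> real \<Rightarrow> (complex ^ 'n \<Rightarrow> complex) \<Rightarrow> ennreal" where
  "fock_norm \<alpha> p f =
     enn_powr (ennreal ((\<alpha> * p / (2 * pi)) ^ CARD('n)) *
       (\<integral>\<^sup>+z. ennreal (norm (f z) powr p * exp (- (\<alpha> * p / 2) * (norm z)\<^sup>2)) \<partial>lborel)) (1 / p)"

definition fock_sobolev :: "real \<Rightarrow> nat \<Rightarrow> real \<Rightarrow> (complex ^ 'n \<Rightarrow> complex) set" where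
  "fock_sobolev \<alpha> m p =
     {f. entire f \<and>
         (\<Sum>\<beta> | (\<Sum>j\<in>UNIV. \<beta> j) \<le> m. fock_norm \<alpha> p (multi_deriv \<beta> f)) < top}"

definition fs_const :: "real \<Rightarrow> nat \<Rightarrow> real \<Rightarrow> nat \<Rightarrow> real" where
  "fs_const \<alpha> m p n =
     (\<alpha> * p / 2) powr (real m * p / 2 + real n) * Gamma (real n) /
       (pi ^ n * Gamma (real m * p / 2 + real n))"

text \<open>
  The weighted norm for finite \<open>p\<close>.  The weight \<open>|z|\<^sup>m\<^sup>p\<close> is written \<open>(|z|\<^sup>m)\<^sup>p\<close> so that it is \<open>1\<close>
  for \<open>m = 0\<close> also at the origin (note \<open>0 powr 0 = 0\<close>).
\<close>
definition fs_norm :: "real \<Rightarrow> nat \<Rightarrow> real \<Rightarrow> (complex ^ 'n \<Rightarrow> complex) \<Rightarrow> ennreal" where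
  "fs_norm \<alpha> m p f =
     enn_powr (ennreal (fs_const \<alpha> m p CARD('n)) *
       (\<integral>\<^sup>+z. ennreal ((norm z ^ m) powr p * norm (f z) powr p *
                       exp (- (\<alpha> * p / 2) * (norm z)\<^sup>2)) \<partial>lborel)) (1 / p)"

definition carleson_bound ::
    "real \<Rightarrow> nat \<Rightarrow> real \<Rightarrow> real \<Rightarrow> (complex ^ 'n) measure \<Rightarrow> real \<Rightarrow> bool" where
  "carleson_bound \<alpha> m p q \<mu> C \<longleftrightarrow>
     C \<ge> 0 \<and>
     (\<forall>f\<in>fock_sobolev \<alpha> m p.
        (\<integral>\<^sup>+z. ennreal (norm (f z) powr q * exp (- (\<alpha> * q / 2) * (norm z)\<^sup>2)) \<partial>\<mu>)
          \<le> ennreal (C powr q) * enn_powr (fs_norm \<alpha> m p f) q)"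

definition fock_carleson ::
    "real \<Rightarrow> nat \<Rightarrow> real \<Rightarrow> real \<Rightarrow> (complex ^ 'n) measure \<Rightarrow> bool" where
  "fock_carleson \<alpha> m p q \<mu> \<longleftrightarrow> (\<exists>C. carleson_bound \<alpha> m p q \<mu> C)"

text \<open>\<open>\<parallel>\<mu>\<parallel>\<close>, with value \<open>\<infinity>\<close> if \<open>\<mu>\<close> is not a Fock--Carleson measure.\<close>
definition carleson_norm ::
    "real \<Rightarrow> nat \<Rightarrow> real \<Rightarrow> real \<Rightarrow> (complex ^ 'n) measure \<Rightarrow> ennreal" where
  "carleson_norm \<alpha> m p q \<mu> = Inf {ennreal C | C. carleson_bound \<alpha> m p q \<mu> C}"

definition berezin ::
    "real \<Rightarrow> real \<Rightarrow> real \<Rightarrow> (complex ^ 'n) measure \<Rightarrow> complex ^ 'n \<Rightarrow> ennreal" where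
  "berezin \<alpha> t s \<mu> w =
     (\<integral>\<^sup>+z. ennreal ((1 + norm z) powr (- s) * exp (- (t * \<alpha> / 2) * (norm (z - w))\<^sup>2)) \<partial>\<mu>)"

definition averaging ::
    "real \<Rightarrow> real \<Rightarrow> (complex ^ 'n) measure \<Rightarrow> complex ^ 'n \<Rightarrow> ennreal" where
  "averaging s r \<mu> z = emeasure \<mu> (ball z r) / ennreal ((1 + norm z) powr s)"

text \<open>The \<open>r/2\<close>-lattices (the parameter is \<open>r\<close>, not \<open>r/2\<close>).\<close>
definition half_lattice :: "real \<Rightarrow> (nat \<Rightarrow> complex ^ 'n) \<Rightarrow> bool" where
  "half_lattice r z \<longleftrightarrow>
     inj z \<and> (\<Union>k. ball (z k) r) = UNIV \<and> disjoint_family (\<lambda>k. ball (z k) (r / 2))"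

text \<open>
  \<open>L\<^sup>\<infinity>\<close> norm with respect to Lebesgue measure; \<^const>\<open>esssup\<close> is \<open>\<infinity>\<close> on non-measurable functions,
  so finiteness includes measurability.
\<close>
definition Linf_norm :: "(complex ^ 'n \<Rightarrow> ennreal) \<Rightarrow> ennreal" where
  "Linf_norm g = esssup lborel g"

definition linf_norm :: "(nat \<Rightarrow> ennreal) \<Rightarrow> ennreal" where
  "linf_norm a = (SUP k. a k)"

text \<open>\<open>U \<simeq> V\<close> for \<open>[0,\<infinity>]\<close>-valued functionals of positive Borel measures.\<close>
definition comparable ::
    "((complex ^ 'n) measure \<Rightarrow> ennreal) \<Rightarrow> ((complex ^ 'n) measure \<Rightarrow> ennreal) \<Rightarrow> bool" where
  "comparable U V \<longleftrightarrow>
     (\<exists>C>0. \<forall>\<mu>. sets \<mu> = sets borel \<longrightarrow>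
        U \<mu> \<le> ennreal C * V \<mu> \<and> V \<mu> \<le> ennreal C * U \<mu>)"

end

theory Submission
  imports Defs "HOL-Probability.Distributions" "HOL-Complex_Analysis.Conformal_Mappings"
begin

text \<open>
  The four quantities are compared in a cycle, always with constants independent of the measure: the
  Carleson norm is controlled by averages over balls (\<open>carleson_dominated_averaging\<close>), averages over balls
  of any radius and Berezin transforms of any parameter control each other
  (\<open>averaging_dominated_berezin\<close>, \<open>berezin_dominated_averaging\<close>), and averages over unit balls are
  controlled by the Carleson norm (\<open>averaging_dominated_carleson\<close>).  Averages at lattice points join the
  cycle because each ball meets boundedly many lattice balls (\<open>averaging_dominated_lattice\<close>).  The
  equivalence of the finiteness conditions, for one or for all parameters, is read off from these
  comparisons; the existence of a lattice is needed for the condition with some lattice.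

  The analytic core is a local estimate (\<open>fock_pointwise_estimate\<close>): the weighted value
  \<open>(1 + |z|)\<^sup>m\<^sup>p |f z|\<^sup>p exp (- \<alpha>p|z|\<^sup>2/2)\<close> of an entire function is at most a constant times the integral
  of the density \<open>|u|\<^sup>m\<^sup>p |f u|\<^sup>p exp (- \<alpha>p|u|\<^sup>2/2)\<close> over a ball of fixed radius about \<open>z\<close>.  A Gaussian
  satisfies a similar inequality with half the exponent.  In both cases a quantity to be integrated
  against \<open>\<mu>\<close> is replaced by a mean over a ball, and Fubini's theorem
  (\<open>nn_integral_ball_mean_le_averaging\<close>) brings out the averages of \<open>\<mu>\<close>.  For the Carleson inequality
  the hypothesis \<open>p \<le> q\<close> allows one to split \<open>X\<^bsup>q/p\<^esup> = X\<^bsup>q/p-1\<^esup> X\<close> and to bound the first factor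
  by the full norm.

  Conversely, normalised reproducing kernels, divided by \<open>(1 + |w|)\<^sup>m\<close>, have bounded
  Fock--Sobolev norm and are bounded below on the unit ball about \<open>w\<close> by a multiple of
  \<open>(1 + |w|)\<^bsup>-m\<^esup>\<close> when weighted by the Gaussian; testing on them recovers the averages.
\<close>

section \<open>Lebesgue measure under translations and isometries\<close>

lemma nn_integral_lborel_translate:
  fixes f :: "'a::euclidean_space \<Rightarrow> ennreal"
  assumes [measurable]: "f \<in> borel_measurable borel"
  shows "(\<integral>\<^sup>+x. f (a + x) \<partial>lborel) = (\<integral>\<^sup>+x. f x \<partial>lborel)"
proof -
  have "(\<integral>\<^sup>+x. f x \<partial>lborel) = (\<integral>\<^sup>+x. f x \<partial>distr lborel borel ((+) a))"
    by (simp add: lborel_distr_plus)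
  also have "\<dots> = (\<integral>\<^sup>+x. f (a + x) \<partial>lborel)"
    by (subst nn_integral_distr) auto
  finally show ?thesis ..
qed

lemma nn_integral_lborel_shift:
  fixes w :: "'a::euclidean_space"
  assumes "(h :: 'a \<Rightarrow> ennreal) \<in> borel_measurable borel"
  shows "(\<integral>\<^sup>+z. h (z - w) \<partial>lborel) = (\<integral>\<^sup>+z. h z \<partial>lborel)"
  using nn_integral_lborel_translate[OF assms, of "- w"] by simp

lemma emeasure_lborel_ball_pos:
  fixes c :: "'a::euclidean_space"
  assumes "r > 0"
  shows "0 < emeasure lborel (ball c r)"
proof -
  have "0 < unit_ball_vol (real DIM('a)) * r ^ DIM('a)"
    using assms by (intro mult_pos_pos unit_ball_vol_pos zero_less_power) auto
  then show ?thesis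
    using assms by (simp only: emeasure_ball less_imp_le ennreal_less_zero_iff)
qed

text \<open>
  Only translation invariance enters, as in the proof that Haar measure is unique.  With \<open>g\<close> the
  indicator of the unit ball, \<open>\<integral>\<integral> f (T x) g y dx dy\<close> is turned by the shifts \<open>x \<mapsto> x + T\<inverse> y\<close> and
  \<open>y \<mapsto> y - T x\<close> into \<open>\<integral> f y (\<integral> g (y - T x) dx) dy\<close>; the inner integral is the volume of a unit
  ball because \<open>T\<close> preserves balls, and this volume cancels.
\<close>

lemma nn_integral_lborel_isometry:
  fixes T :: "'a::euclidean_space \<Rightarrow> 'a" and f :: "'a \<Rightarrow> ennreal"
  assumes lin: "linear T" and iso: "\<And>x. norm (T x) = norm x"
    and f [measurable]: "f \<in> borel_measurable borel"
  shows "(\<integral>\<^sup>+x. f (T x) \<partial>lborel) = (\<integral>\<^sup>+x. f x \<partial>lborel)"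
proof -
  have [measurable]: "T \<in> borel_measurable borel"
    using lin by (intro borel_measurable_continuous_onI linear_continuous_on linear_conv_bounded_linear[THEN iffD1])
  have "inj T"
    using lin iso by (metis linear_injective_0 norm_eq_zero)
  then have "surj T"
    using lin linear_injective_imp_surjective by blast
  then obtain S where S: "\<And>y. T (S y) = y"
    by (metis surj_f_inv_f)
  define g :: "'a \<Rightarrow> ennreal" where "g = indicator (ball 0 1)"
  define V where "V = emeasure lborel (ball (0::'a) 1)"
  have [measurable]: "g \<in> borel_measurable borel"
    unfolding g_def by (intro borel_measurable_indicator) simp
  have Tadd: "T (x + y) = T x + T y" for x y
    using lin by (simp add: linear_add)
  have Tdiff: "T (x - y) = T x - T y" for x y
    using lin by (simp add: linear_diff)
  have gint: "(\<integral>\<^sup>+x. g (y - T x) \<partial>lborel) = V" for y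
  proof -
    have "g (y - T x) = indicator (ball (S y) 1) x" for x
    proof -
      have "norm (y - T x) = norm (S y - x)"
        by (metis S Tdiff iso)
      then show ?thesis
        by (auto simp: g_def indicator_def dist_norm norm_minus_commute)
    qed
    then have "(\<integral>\<^sup>+x. g (y - T x) \<partial>lborel) = emeasure lborel (ball (S y) 1)"
      by simp
    also have "\<dots> = V"
      by (simp add: V_def emeasure_ball)
    finally show ?thesis .
  qed
  have gV: "(\<integral>\<^sup>+y. g y \<partial>lborel) = V"
    by (simp add: g_def V_def)
  have "(\<integral>\<^sup>+x. f (T x) \<partial>lborel) * V = (\<integral>\<^sup>+y. (\<integral>\<^sup>+x. f (T x) \<partial>lborel) * g y \<partial>lborel)"
    by (simp add: nn_integral_cmult gV)
  also have "\<dots> = (\<integral>\<^sup>+y. (\<integral>\<^sup>+x. f (T x + y) * g y \<partial>lborel) \<partial>lborel)"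
  proof (rule nn_integral_cong)
    fix y
    have "(\<integral>\<^sup>+x. f (T x) \<partial>lborel) = (\<integral>\<^sup>+x. f (T (S y + x)) \<partial>lborel)"
      by (rule nn_integral_lborel_translate[symmetric]) simp
    also have "\<dots> = (\<integral>\<^sup>+x. f (T x + y) \<partial>lborel)"
      by (simp add: Tadd S add.commute)
    finally show "(\<integral>\<^sup>+x. f (T x) \<partial>lborel) * g y = (\<integral>\<^sup>+x. f (T x + y) * g y \<partial>lborel)"
      by (simp add: nn_integral_multc)
  qed
  also have "\<dots> = (\<integral>\<^sup>+x. (\<integral>\<^sup>+y. f (T x + y) * g y \<partial>lborel) \<partial>lborel)"
    by (rule lborel_pair.Fubini') simp
  also have "\<dots> = (\<integral>\<^sup>+x. (\<integral>\<^sup>+y. f y * g (y - T x) \<partial>lborel) \<partial>lborel)"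
  proof (rule nn_integral_cong)
    fix x
    show "(\<integral>\<^sup>+y. f (T x + y) * g y \<partial>lborel) = (\<integral>\<^sup>+y. f y * g (y - T x) \<partial>lborel)"
      using nn_integral_lborel_translate[of "\<lambda>y. f y * g (y - T x)" "T x"] by simp
  qed
  also have "\<dots> = (\<integral>\<^sup>+y. (\<integral>\<^sup>+x. f y * g (y - T x) \<partial>lborel) \<partial>lborel)"
    by (rule lborel_pair.Fubini') simp
  also have "\<dots> = (\<integral>\<^sup>+y. f y * V \<partial>lborel)"
    by (simp add: nn_integral_cmult gint)
  also have "\<dots> = (\<integral>\<^sup>+y. f y \<partial>lborel) * V"
    by (simp add: nn_integral_multc)
  finally have "(\<integral>\<^sup>+x. f (T x) \<partial>lborel) * V = (\<integral>\<^sup>+y. f y \<partial>lborel) * V" .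
  moreover have "V \<noteq> 0" "V \<noteq> top"
    using emeasure_lborel_ball_pos[of 1 "0 :: 'a"] emeasure_lborel_ball_finite[of "0 :: 'a" 1]
    unfolding V_def by auto
  ultimately show ?thesis
    by (metis ennreal_mult_cancel_left mult.commute)
qed

section \<open>The sub-mean value property of \<open>|g|\<^sup>p\<close>\<close>

lemma norm_holomorphic_le_circle_mean:
  assumes "\<phi> holomorphic_on UNIV"
  shows "ennreal (norm (\<phi> 0)) \<le> (\<integral>\<^sup>+x\<in>{0..1}. ennreal (norm (\<phi> (cis (2 * pi * x)))) \<partial>lborel)"
proof -
  have cont: "continuous_on UNIV \<phi>"
    using assms holomorphic_on_imp_continuous_on by blast
  have "((\<lambda>u. \<phi> u / (u - 0)) has_contour_integral (2 * of_real pi * \<i> * \<phi> 0)) (circlepath 0 1)"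
    by (rule Cauchy_integral_circlepath)
       (auto intro: continuous_on_subset[OF cont] holomorphic_on_subset[OF assms])
  then have "((\<lambda>x. \<phi> (cis (2 * pi * x)) / cis (2 * pi * x) * (2 * pi * \<i> * cis (2 * pi * x)))
      has_integral (2 * of_real pi * \<i> * \<phi> 0)) {0..1}"
    unfolding has_contour_integral_def
  proof (rule has_integral_eq[rotated])
    fix x :: real
    assume x: "x \<in> {0..1}"
    have *: "exp (2 * complex_of_real pi * \<i> * complex_of_real x) = cis (2 * pi * x)"
      by (simp add: cis_conv_exp mult_ac)
    have "circlepath 0 1 x = cis (2 * pi * x)"
      by (simp add: circlepath *)
    moreover have "vector_derivative (circlepath 0 1) (at x within {0..1}) = 2 * pi * \<i> * cis (2 * pi * x)"
      using x by (simp add: vector_derivative_circlepath01 *)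
    ultimately show "\<phi> (circlepath 0 1 x) / (circlepath 0 1 x - 0) * vector_derivative (circlepath 0 1) (at x within {0..1}) =
        \<phi> (cis (2 * pi * x)) / cis (2 * pi * x) * (2 * pi * \<i> * cis (2 * pi * x))"
      by simp
  qed
  then have "((\<lambda>x. (2 * of_real pi * \<i>) * \<phi> (cis (2 * pi * x))) has_integral (2 * of_real pi * \<i> * \<phi> 0)) {0..1}"
    by (rule has_integral_eq[rotated]) (auto simp: field_simps)
  then have "((\<lambda>x. (1 / (2 * of_real pi * \<i>)) * ((2 * of_real pi * \<i>) * \<phi> (cis (2 * pi * x)))) has_integral
      (1 / (2 * of_real pi * \<i>)) * (2 * of_real pi * \<i> * \<phi> 0)) {0..1}"
    by (rule has_integral_mult_right)
  then have hi: "((\<lambda>x. \<phi> (cis (2 * pi * x))) has_integral \<phi> 0) {0..1}"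
    by simp
  have c1: "continuous_on UNIV (\<lambda>x::real. \<phi> (cis (2 * pi * x)))"
    by (intro continuous_on_compose2[OF cont] continuous_intros) auto
  have c2: "continuous_on {0..1} (\<lambda>x::real. norm (\<phi> (cis (2 * pi * x))))"
    by (intro continuous_intros continuous_on_subset[OF c1]) auto
  define I where "I = integral {0..1} (\<lambda>x::real. norm (\<phi> (cis (2 * pi * x))))"
  have hiI: "((\<lambda>x::real. norm (\<phi> (cis (2 * pi * x)))) has_integral I) {0..1}"
    unfolding I_def by (intro integrable_integral integrable_continuous_interval c2)
  have "norm (\<phi> 0) \<le> I \<bullet> 1"
    by (rule has_integral_norm_bound_integral_component[OF hi hiI]) simp
  moreover have "(\<integral>\<^sup>+x\<in>{0..1}. ennreal (norm (\<phi> (cis (2 * pi * x)))) \<partial>lborel) = ennreal I"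
    by (rule nn_integral_has_integral_lebesgue'[OF _ hiI]) simp
  ultimately show ?thesis
    by (simp add: ennreal_leI)
qed

text \<open>
  All that the estimates use of an entire function is that it is continuous and holomorphic along every
  complex line.  This property passes to products and powers by one-variable calculus.
\<close>

definition line_holomorphic :: "(complex ^ 'n \<Rightarrow> complex) \<Rightarrow> bool" where
  "line_holomorphic g \<longleftrightarrow>
     continuous_on UNIV g \<and> (\<forall>a v. (\<lambda>\<zeta>. g (a + \<zeta> *s v)) holomorphic_on UNIV)"

lemma line_holomorphic_measurable:
  "line_holomorphic g \<Longrightarrow> g \<in> borel_measurable borel"
  by (simp add: line_holomorphic_def borel_measurable_continuous_onI)

lemma line_holomorphic_mult:
  assumes "line_holomorphic f" "line_holomorphic g"
  shows "line_holomorphic (\<lambda>z. f z * g z)"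
  using assms by (auto simp: line_holomorphic_def intro!: holomorphic_intros continuous_intros)

lemma line_holomorphic_power:
  assumes "line_holomorphic f"
  shows "line_holomorphic (\<lambda>z. f z ^ N)"
  using assms by (auto simp: line_holomorphic_def intro!: holomorphic_intros continuous_intros)

lemma norm_vector_scalar_mult: "norm (c *s v) = norm c * norm (v :: complex ^ 'n)"
  by (simp add: norm_vec_def norm_mult L2_set_right_distrib)

lemma linear_vector_scalar_mult: "linear (\<lambda>v :: complex ^ 'n. c *s v)"
  by (rule linearI) (auto simp: vec_eq_iff algebra_simps)

lemma bounded_linear_vector_scalar_mult_left: "bounded_linear (\<lambda>\<zeta>. \<zeta> *s (v :: complex ^ 'n))"
  by (rule linear_conv_bounded_linear[THEN iffD1], rule linearI) (auto simp: vec_eq_iff algebra_simps)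

lemma entire_imp_line_holomorphic:
  fixes f :: "complex ^ 'n \<Rightarrow> complex"
  assumes "entire f"
  shows "line_holomorphic f"
  unfolding line_holomorphic_def
proof (intro conjI allI)
  have "continuous (at z) f" for z
    using assms unfolding entire_def by (meson has_derivative_continuous)
  then show "continuous_on UNIV f"
    by (simp add: continuous_on_eq_continuous_at)
next
  fix a v :: "complex ^ 'n"
  have "(\<lambda>\<zeta>. f (a + \<zeta> *s v)) field_differentiable (at \<zeta>)" for \<zeta>
  proof -
    obtain D where D: "(f has_derivative D) (at (a + \<zeta> *s v))" and lin: "\<And>c v. D (c *s v) = c * D v"
      using assms unfolding entire_def by blast
    have "((\<lambda>\<zeta>. a + \<zeta> *s v) has_derivative (\<lambda>\<zeta>. \<zeta> *s v)) (at \<zeta>)"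
      by (auto intro!: derivative_eq_intros bounded_linear.has_derivative[OF bounded_linear_vector_scalar_mult_left])
    from has_derivative_compose[OF this D]
    have "((\<lambda>\<zeta>. f (a + \<zeta> *s v)) has_derivative (\<lambda>h. h * D v)) (at \<zeta>)"
      by (simp add: lin)
    then have "((\<lambda>\<zeta>. f (a + \<zeta> *s v)) has_field_derivative D v) (at \<zeta>)"
      by (simp add: has_field_derivative_def mult.commute[of _ "D v"])
    then show ?thesis
      unfolding field_differentiable_def by blast
  qed
  then show "(\<lambda>\<zeta>. f (a + \<zeta> *s v)) holomorphic_on UNIV"
    by (simp add: holomorphic_on_def)
qed

text \<open>
  Average the one-variable mean value property along the circles \<open>a + e\<^sup>i\<^sup>\<theta> v\<close> over all \<open>v\<close> in the ball
  and exchange the two integrals: each rotation \<open>v \<mapsto> e\<^sup>i\<^sup>\<theta> v\<close> preserves both the ball and Lebesgue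
  measure, so the average over \<open>\<theta>\<close> disappears.
\<close>

lemma norm_mult_ball_le_integral:
  fixes g :: "complex ^ 'n \<Rightarrow> complex"
  assumes g: "line_holomorphic g"
  shows "ennreal (norm (g a)) * emeasure lborel (ball a d)
      \<le> (\<integral>\<^sup>+u\<in>ball a d. ennreal (norm (g u)) \<partial>lborel)"
proof -
  note [measurable] = line_holomorphic_measurable[OF g]
  define F where "F v = ennreal (norm (g (a + v))) * indicator (ball 0 d) v" for v
  have [measurable]: "ball (0 :: complex ^ 'n) d \<in> sets borel" "ball a d \<in> sets borel"
    by simp_all
  have [measurable]: "F \<in> borel_measurable borel"
    unfolding F_def by measurable
  have rot [measurable]: "(\<lambda>x. cis (2 * pi * fst x) *s (snd x :: complex ^ 'n)) \<in> borel_measurable (borel \<Otimes>\<^sub>M borel)"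
    unfolding borel_prod
    by (intro borel_measurable_continuous_onI) (auto simp: vector_scalar_mult_def intro!: continuous_intros)
  have meas: "(\<lambda>x. F (cis (2 * pi * fst x) *s snd x) * indicator {0..1} (fst x))
      \<in> borel_measurable (borel \<Otimes>\<^sub>M borel)"
    by measurable
  have rotF: "(\<integral>\<^sup>+v. F (cis x *s v) \<partial>lborel) = (\<integral>\<^sup>+v. F v \<partial>lborel)" for x
    by (rule nn_integral_lborel_isometry[OF linear_vector_scalar_mult])
       (auto simp: norm_vector_scalar_mult)
  have "emeasure lborel (ball a d) = emeasure lborel (ball (0 :: complex ^ 'n) d)"
    by (cases "d \<le> 0") (auto simp: emeasure_ball ball_empty)
  then have "ennreal (norm (g a)) * emeasure lborel (ball a d)
      = (\<integral>\<^sup>+v. ennreal (norm (g a)) * indicator (ball (0 :: complex ^ 'n) d) v \<partial>lborel)"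
    by (simp add: nn_integral_cmult_indicator)
  also have "\<dots> \<le> (\<integral>\<^sup>+v. (\<integral>\<^sup>+x. F (cis (2 * pi * x) *s v) * indicator {0..1} x \<partial>lborel) \<partial>lborel)"
  proof (rule nn_integral_mono)
    fix v :: "complex ^ 'n"
    show "ennreal (norm (g a)) * indicator (ball 0 d) v
        \<le> (\<integral>\<^sup>+x. F (cis (2 * pi * x) *s v) * indicator {0..1} x \<partial>lborel)"
    proof (cases "norm v < d")
      case True
      have "(\<lambda>\<zeta>. g (a + \<zeta> *s v)) holomorphic_on UNIV"
        using g by (simp add: line_holomorphic_def)
      from norm_holomorphic_le_circle_mean[OF this] show ?thesis
        using True by (simp add: F_def norm_vector_scalar_mult)
    qed auto
  qed
  also have "\<dots> = (\<integral>\<^sup>+x. (\<integral>\<^sup>+v. F (cis (2 * pi * x) *s v) * indicator {0..1} x \<partial>lborel) \<partial>lborel)"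
    using meas by (intro lborel_pair.Fubini') (simp add: case_prod_beta')
  also have "\<dots> = (\<integral>\<^sup>+x. (\<integral>\<^sup>+v. F v \<partial>lborel) * indicator {0..1::real} x \<partial>lborel)"
  proof (rule nn_integral_cong)
    fix x :: real
    have [measurable]: "(\<lambda>v :: complex ^ 'n. cis (2 * pi * x) *s v) \<in> borel_measurable borel"
      by (intro borel_measurable_continuous_onI)
         (auto simp: vector_scalar_mult_def intro!: continuous_intros)
    have "(\<lambda>v. F (cis (2 * pi * x) *s v)) \<in> borel_measurable lborel"
      by measurable
    then show "(\<integral>\<^sup>+v. F (cis (2 * pi * x) *s v) * indicator {0..1} x \<partial>lborel)
        = (\<integral>\<^sup>+v. F v \<partial>lborel) * indicator {0..1} x"
      by (simp add: nn_integral_multc rotF)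
  qed
  also have "\<dots> = (\<integral>\<^sup>+v. F v \<partial>lborel)"
    by (simp add: nn_integral_cmult_indicator)
  also have "\<dots> = (\<integral>\<^sup>+u\<in>ball a d. ennreal (norm (g u)) \<partial>lborel)"
  proof -
    have "F v = ennreal (norm (g (a + v))) * indicator (ball a d) (a + v)" for v
      by (simp add: F_def indicator_def dist_norm)
    then show ?thesis
      using nn_integral_lborel_translate[of "\<lambda>u. ennreal (norm (g u)) * indicator (ball a d) u" a]
      by simp
  qed
  finally show ?thesis .
qed

text \<open>
  For \<open>p < 1\<close> the power \<open>|g|\<^sup>p\<close> cannot be reached from \<open>|g|\<close> by Jensen's inequality.  Instead let
  \<open>z0\<close> maximise \<open>(1 - |z - a|)\<^sup>d |g z|\<^sup>p\<close> on the closed unit ball about \<open>a\<close>, where \<open>d\<close> is the real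
  dimension.  On the ball of radius \<open>\<delta> = (1 - |z0 - a|) / 2\<close> about \<open>z0\<close> the weight drops by a factor of at
  most \<open>2\<^sup>d\<close>, so \<open>|g|\<^sup>p \<le> 2\<^sup>d |g z0|\<^sup>p\<close> there.  Hence \<open>|g| = |g|\<^bsup>1-p\<^esup> |g|\<^sup>p\<close> is at most a multiple of
  \<open>|g z0|\<^bsup>1-p\<^esup> |g|\<^sup>p\<close>, and the mean value inequality for \<open>|g|\<close> at \<open>z0\<close> bounds \<open>\<delta>\<^sup>d |g z0|\<^sup>p\<close>,
  and with it \<open>|g a|\<^sup>p\<close>, by the integral of \<open>|g|\<^sup>p\<close>.
\<close>

lemma sub_mean_value_powr_le_one:
  fixes g :: "complex ^ 'n \<Rightarrow> complex"
  assumes p: "0 < p" "p \<le> 1" and g: "line_holomorphic g"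
  shows "ennreal (norm (g a) powr p) \<le>
     ennreal (2 ^ DIM(complex ^ 'n) * (2 ^ DIM(complex ^ 'n)) powr (1 / p - 1) / unit_ball_vol (DIM(complex ^ 'n)))
       * (\<integral>\<^sup>+u\<in>ball a 1. ennreal (norm (g u) powr p) \<partial>lborel)"
proof -
  define d where "d = DIM(complex ^ 'n)"
  define \<kappa> where "\<kappa> = unit_ball_vol d"
  define K where "K = 2 ^ d * (2 ^ d) powr (1 / p - 1) / \<kappa>"
  define G where "G z = norm (g z) powr p" for z
  have \<kappa>: "\<kappa> > 0" and d: "d > 0"
    by (auto simp: \<kappa>_def d_def)
  have K: "K > 0"
    using \<kappa> by (simp add: K_def)
  note [measurable] = line_holomorphic_measurable[OF g]
  have [measurable]: "ball a 1 \<in> sets borel"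
    by simp
  have contg: "continuous_on UNIV g"
    using g by (simp add: line_holomorphic_def)
  have contG: "continuous_on UNIV G"
    unfolding G_def using p by (intro continuous_intros continuous_on_powr' contg) auto
  have G0: "G z \<ge> 0" for z
    by (simp add: G_def)
  have "ennreal (G a) \<le> ennreal K * (\<integral>\<^sup>+u\<in>ball a 1. ennreal (G u) \<partial>lborel)"
  proof (cases "G a = 0 \<or> (\<integral>\<^sup>+u\<in>ball a 1. ennreal (G u) \<partial>lborel) = top")
    case True
    then show ?thesis
      using K by (auto simp: ennreal_mult_top)
  next
    case False
    then obtain J where J: "(\<integral>\<^sup>+u\<in>ball a 1. ennreal (G u) \<partial>lborel) = ennreal J" "J \<ge> 0"
      by (cases "\<integral>\<^sup>+u\<in>ball a 1. ennreal (G u) \<partial>lborel") auto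
    from False have Ga: "G a > 0"
      using G0[of a] by linarith
    define h where "h z = (1 - dist a z) ^ d * G z" for z
    have "continuous_on (cball a 1) h"
      unfolding h_def by (intro continuous_intros continuous_on_subset[OF contG]) auto
    then obtain z0 where z0: "z0 \<in> cball a 1" "\<And>z. z \<in> cball a 1 \<Longrightarrow> h z \<le> h z0"
      using continuous_attains_sup[of "cball a 1" h] by auto
    have ha: "h a = G a"
      by (simp add: h_def)
    have hz0: "h z0 \<ge> G a"
      using z0(2)[of a] ha by simp
    define \<delta> where "\<delta> = (1 - dist a z0) / 2"
    have "dist a z0 \<noteq> 1"
      using hz0 Ga d by (auto simp: h_def zero_power)
    then have \<delta>: "\<delta> > 0"
      using z0(1) by (auto simp: \<delta>_def)
    have hz0': "h z0 = 2 ^ d * \<delta> ^ d * G z0"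
      by (simp add: h_def \<delta>_def power_divide)
    have ball_sub: "z \<in> ball a 1" and G_le: "G z \<le> 2 ^ d * G z0" if z: "z \<in> ball z0 \<delta>" for z
    proof -
      have "dist a z \<le> dist a z0 + dist z0 z"
        by (rule dist_triangle)
      then have *: "\<delta> \<le> 1 - dist a z"
        using z by (simp add: \<delta>_def field_simps)
      then show "z \<in> ball a 1"
        using \<delta> by simp
      then have "h z \<le> h z0"
        using z0(2) by simp
      moreover have "\<delta> ^ d * G z \<le> h z"
        unfolding h_def using * \<delta> G0 by (intro mult_right_mono power_mono) auto
      ultimately have "\<delta> ^ d * G z \<le> \<delta> ^ d * (2 ^ d * G z0)"
        by (simp add: hz0' mult_ac)
      then show "G z \<le> 2 ^ d * G z0"
        using \<delta> by simp
    qed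
    have split: "norm (g z) = G z powr (1 / p - 1) * G z" for z
    proof -
      have "norm (g z) = G z powr ((1 / p - 1) + 1)"
        using p by (simp add: G_def powr_powr)
      also have "\<dots> = G z powr (1 / p - 1) * G z"
        unfolding powr_add using G0[of z] by simp
      finally show ?thesis .
    qed
    define Q where "Q = (2 ^ d * G z0) powr (1 / p - 1)"
    have g_le: "norm (g z) \<le> Q * G z" if z: "z \<in> ball z0 \<delta>" for z
      unfolding split[of z] Q_def using G_le[OF z] G0 p
      by (intro mult_right_mono powr_mono2) auto
    have "ennreal (norm (g z0) * (\<kappa> * \<delta> ^ d)) = ennreal (norm (g z0)) * emeasure lborel (ball z0 \<delta>)"
      using \<delta> \<kappa> by (simp add: emeasure_ball ennreal_mult \<kappa>_def d_def)
    also have "\<dots> \<le> (\<integral>\<^sup>+u\<in>ball z0 \<delta>. ennreal (norm (g u)) \<partial>lborel)"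
      by (rule norm_mult_ball_le_integral[OF g])
    also have "\<dots> \<le> (\<integral>\<^sup>+u. ennreal Q * (ennreal (G u) * indicator (ball a 1) u) \<partial>lborel)"
    proof (rule nn_integral_mono)
      fix u
      show "ennreal (norm (g u)) * indicator (ball z0 \<delta>) u \<le> ennreal Q * (ennreal (G u) * indicator (ball a 1) u)"
        using g_le[of u] ball_sub[of u] G0[of u]
        by (cases "u \<in> ball z0 \<delta>") (auto simp: Q_def ennreal_mult'[symmetric] intro!: ennreal_leI)
    qed
    also have "\<dots> = ennreal Q * ennreal J"
      unfolding J(1)[symmetric] by (subst nn_integral_cmult) (auto simp: G_def)
    also have "\<dots> = ennreal (Q * J)"
      by (rule ennreal_mult'[symmetric]) (simp add: Q_def)
    finally have "norm (g z0) * (\<kappa> * \<delta> ^ d) \<le> Q * J"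
      using J(2) by (simp add: Q_def)
    moreover have "Q = (2 ^ d) powr (1 / p - 1) * G z0 powr (1 / p - 1)"
      unfolding Q_def using G0[of z0] by (simp add: powr_mult)
    ultimately have "G z0 powr (1 / p - 1) * (G z0 * (\<kappa> * \<delta> ^ d))
        \<le> G z0 powr (1 / p - 1) * ((2 ^ d) powr (1 / p - 1) * J)"
      by (simp add: split[of z0] mult_ac)
    moreover have "G z0 > 0"
      using hz0 Ga G0[of z0] by (cases "G z0 = 0") (auto simp: hz0')
    ultimately have "G z0 * (\<kappa> * \<delta> ^ d) \<le> (2 ^ d) powr (1 / p - 1) * J"
      by simp
    then have "\<delta> ^ d * G z0 \<le> (2 ^ d) powr (1 / p - 1) * J / \<kappa>"
      using \<kappa> by (simp add: field_simps)
    then have "2 ^ d * (\<delta> ^ d * G z0) \<le> 2 ^ d * ((2 ^ d) powr (1 / p - 1) * J / \<kappa>)"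
      by (rule mult_left_mono) simp
    then have "G a \<le> K * J"
      using hz0 by (simp add: hz0' K_def mult_ac)
    then show ?thesis
      using K J by (simp add: ennreal_mult'[symmetric] ennreal_leI)
  qed
  then show ?thesis
    by (simp add: G_def K_def \<kappa>_def d_def)
qed

text \<open>
  For \<open>p > 1\<close> the previous estimate is applied to \<open>g\<^sup>N\<close> with exponent \<open>p / N \<le> 1\<close>.
\<close>

lemma sub_mean_value_powr:
  fixes p :: real
  assumes p: "0 < p"
  shows "\<exists>K>0. \<forall>g a. line_holomorphic (g :: complex ^ 'n \<Rightarrow> complex) \<longrightarrow>
     ennreal (norm (g a) powr p) \<le> ennreal K * (\<integral>\<^sup>+u\<in>ball a 1. ennreal (norm (g u) powr p) \<partial>lborel)"
proof -
  define N where "N = nat \<lceil>p\<rceil>"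
  have N: "N > 0" "p \<le> real N"
    using p by (auto simp: N_def)
  define s where "s = p / real N"
  have s: "0 < s" "s \<le> 1"
    using N p by (auto simp: s_def)
  have pow: "norm (x ^ N) powr s = norm x powr p" for x :: complex
    using N by (cases "x = 0") (auto simp: norm_power s_def powr_powr powr_realpow[symmetric])
  show ?thesis
    using sub_mean_value_powr_le_one[OF s line_holomorphic_power[where N = N], where 'n = 'n] s
    unfolding pow
    by (intro exI[of _ "2 ^ DIM(complex ^ 'n) * (2 ^ DIM(complex ^ 'n)) powr (1 / s - 1) / unit_ball_vol (DIM(complex ^ 'n))"])
       auto
qed

section \<open>Pointwise estimates with Gaussian weights\<close>

definition hermitian :: "complex ^ 'n \<Rightarrow> complex ^ 'n \<Rightarrow> complex" where
  "hermitian z w = (\<Sum>i\<in>UNIV. z $ i * cnj (w $ i))"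

lemma hermitian_add_left: "hermitian (x + y) w = hermitian x w + hermitian y w"
  by (simp add: hermitian_def sum.distrib algebra_simps)

lemma hermitian_scale_left: "hermitian (c *s x) w = c * hermitian x w"
  by (simp add: hermitian_def sum_distrib_left mult_ac)

lemma Re_hermitian: "Re (hermitian z w) = z \<bullet> w"
  by (simp add: hermitian_def inner_vec_def inner_complex_def)

lemma norm_diff_square_hermitian: "(norm (z - w))\<^sup>2 = (norm z)\<^sup>2 - 2 * Re (hermitian z w) + (norm w)\<^sup>2"
  by (simp add: Re_hermitian power2_norm_eq_inner inner_diff_left inner_diff_right inner_commute)

lemma bounded_linear_hermitian: "bounded_linear (\<lambda>z. hermitian z w)"
proof (rule linear_conv_bounded_linear[THEN iffD1], rule linearI)
  show "hermitian (r *\<^sub>R z) w = r *\<^sub>R hermitian z w" for r z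
    by (simp add: hermitian_def scaleR_sum_right)
qed (rule hermitian_add_left)

lemma entire_exp_hermitian: "entire (\<lambda>z. exp (b * hermitian z w + c))"
  unfolding entire_def
proof
  fix z
  have "((\<lambda>z. b * hermitian z w + c) has_derivative (\<lambda>v. b * hermitian v w)) (at z)"
    by (intro has_derivative_add_const has_derivative_mult_right bounded_linear_imp_has_derivative
          bounded_linear_hermitian)
  from has_derivative_compose[OF this DERIV_exp[unfolded has_field_derivative_def]]
  have "((\<lambda>z. exp (b * hermitian z w + c)) has_derivative
      (\<lambda>v. exp (b * hermitian z w + c) * (b * hermitian v w))) (at z)" .
  then show "\<exists>D. ((\<lambda>z. exp (b * hermitian z w + c)) has_derivative D) (at z) \<and> (\<forall>c v. D (c *s v) = c * D v)"
    by (intro exI conjI) (auto simp: hermitian_scale_left)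
qed

text \<open>
  The Gaussian weight is absorbed by a holomorphic factor: with
  \<open>g u = f u exp (- \<alpha> \<langle>u,a\<rangle> + \<alpha>|a|\<^sup>2/2)\<close> one has
  \<open>|g u| = |f u| exp (- \<alpha>|u|\<^sup>2/2) exp (\<alpha>|u - a|\<^sup>2/2)\<close>, and the last factor is bounded on the unit ball
  about \<open>a\<close> and equal to \<open>1\<close> at \<open>a\<close>.
\<close>

lemma fock_pointwise_estimate_unweighted:
  fixes \<alpha> p :: real
  assumes \<alpha>: "\<alpha> > 0" and p: "p > 0"
  shows "\<exists>K>0. \<forall>f a. line_holomorphic (f :: complex ^ 'n \<Rightarrow> complex) \<longrightarrow>
     ennreal (norm (f a) powr p * exp (- (\<alpha> * p / 2) * (norm a)\<^sup>2))
       \<le> ennreal K * (\<integral>\<^sup>+u\<in>ball a 1. ennreal (norm (f u) powr p * exp (- (\<alpha> * p / 2) * (norm u)\<^sup>2)) \<partial>lborel)"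
proof -
  obtain K where K: "K > 0" and est: "\<And>g a. line_holomorphic (g :: complex ^ 'n \<Rightarrow> complex) \<Longrightarrow>
     ennreal (norm (g a) powr p) \<le> ennreal K * (\<integral>\<^sup>+u\<in>ball a 1. ennreal (norm (g u) powr p) \<partial>lborel)"
    using sub_mean_value_powr[OF p] by blast
  define c where "c = \<alpha> * p / 2"
  have c: "c > 0"
    using \<alpha> p by (simp add: c_def)
  have "ennreal (norm (f a) powr p * exp (- c * (norm a)\<^sup>2))
       \<le> ennreal (K * exp c) * (\<integral>\<^sup>+u\<in>ball a 1. ennreal (norm (f u) powr p * exp (- c * (norm u)\<^sup>2)) \<partial>lborel)"
    if f: "line_holomorphic f" for f :: "complex ^ 'n \<Rightarrow> complex" and a
  proof -
    note [measurable] = line_holomorphic_measurable[OF f]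
    have [measurable]: "ball a 1 \<in> sets borel"
      by simp
    define g where "g u = f u * exp (- \<alpha> * hermitian u a + \<alpha> / 2 * (norm a)\<^sup>2)" for u
    have g: "line_holomorphic g"
      unfolding g_def
      by (intro line_holomorphic_mult f entire_imp_line_holomorphic entire_exp_hermitian)
    have gu: "norm (g u) powr p = norm (f u) powr p * exp (- c * (norm u)\<^sup>2) * exp (c * (norm (u - a))\<^sup>2)" for u
    proof -
      have "norm (g u) powr p = norm (f u) powr p * exp ((- \<alpha> * Re (hermitian u a) + \<alpha> / 2 * (norm a)\<^sup>2) * p)"
        by (simp add: g_def norm_mult powr_mult exp_powr_real)
      also have "(- \<alpha> * Re (hermitian u a) + \<alpha> / 2 * (norm a)\<^sup>2) * p = - c * (norm u)\<^sup>2 + c * (norm (u - a))\<^sup>2"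
        by (simp add: norm_diff_square_hermitian c_def algebra_simps)
      finally show ?thesis
        by (simp only: exp_add mult.assoc)
    qed
    have "ennreal (norm (f a) powr p * exp (- c * (norm a)\<^sup>2)) = ennreal (norm (g a) powr p)"
      by (simp add: gu)
    also have "\<dots> \<le> ennreal K * (\<integral>\<^sup>+u\<in>ball a 1. ennreal (norm (g u) powr p) \<partial>lborel)"
      by (rule est[OF g])
    also have "(\<integral>\<^sup>+u\<in>ball a 1. ennreal (norm (g u) powr p) \<partial>lborel)
        \<le> (\<integral>\<^sup>+u. ennreal (exp c) * (ennreal (norm (f u) powr p * exp (- c * (norm u)\<^sup>2)) * indicator (ball a 1) u) \<partial>lborel)"
    proof (rule nn_integral_mono)
      fix u
      have "exp (c * (norm (u - a))\<^sup>2) \<le> exp c" if "u \<in> ball a 1"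
      proof -
        have "(norm (u - a))\<^sup>2 \<le> 1"
          using that by (simp add: dist_norm norm_minus_commute power_le_one)
        then show ?thesis
          using c by simp
      qed
      then have "norm (g u) powr p \<le> exp c * (norm (f u) powr p * exp (- c * (norm u)\<^sup>2))" if "u \<in> ball a 1"
        unfolding gu using that by (subst mult.commute) (intro mult_right_mono, auto)
      then show "ennreal (norm (g u) powr p) * indicator (ball a 1) u
          \<le> ennreal (exp c) * (ennreal (norm (f u) powr p * exp (- c * (norm u)\<^sup>2)) * indicator (ball a 1) u)"
        by (cases "u \<in> ball a 1") (auto simp: ennreal_mult'[symmetric] intro!: ennreal_leI)
    qed
    also have "\<dots> = ennreal (exp c) * (\<integral>\<^sup>+u\<in>ball a 1. ennreal (norm (f u) powr p * exp (- c * (norm u)\<^sup>2)) \<partial>lborel)"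
      by (rule nn_integral_cmult) measurable
    finally show ?thesis
      using K by (simp add: ennreal_mult' mult_left_mono mult.assoc)
  qed
  then show ?thesis
    using K by (intro exI[of _ "K * exp c"]) (auto simp: c_def)
qed

text \<open>
  The one-variable maximum modulus principle on the complex line through \<open>0\<close> and \<open>a\<close>.
\<close>

lemma line_holomorphic_max_on_sphere:
  fixes f :: "complex ^ 'n \<Rightarrow> complex"
  assumes f: "line_holomorphic f" and a: "norm a < R"
  obtains b where "norm b = R" "norm (f a) \<le> norm (f b)"
proof -
  obtain e :: "complex ^ 'n" where e: "norm e = 1"
    using vector_choose_size[of 1] by auto
  define v where "v = (if a = 0 then e else complex_of_real (1 / norm a) *s a)"
  have v: "norm v = 1"
    using e by (auto simp: v_def norm_vector_scalar_mult norm_divide)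
  have av: "a = complex_of_real (norm a) *s v"
    by (auto simp: v_def vec_eq_iff)
  define \<phi> where "\<phi> \<zeta> = f (0 + \<zeta> *s v)" for \<zeta>
  have hol: "\<phi> holomorphic_on UNIV"
    using f unfolding line_holomorphic_def \<phi>_def by blast
  have cont: "continuous_on UNIV \<phi>"
    using hol holomorphic_on_imp_continuous_on by blast
  have "R > 0"
    using a norm_ge_zero[of a] by linarith
  then have "sphere (0 :: complex) R \<noteq> {}"
    by simp
  moreover have "continuous_on (sphere 0 R) (\<lambda>\<zeta>. norm (\<phi> \<zeta>))"
    by (intro continuous_intros continuous_on_subset[OF cont]) auto
  ultimately obtain \<xi> where \<xi>: "\<xi> \<in> sphere 0 R" "\<And>\<zeta>. \<zeta> \<in> sphere 0 R \<Longrightarrow> norm (\<phi> \<zeta>) \<le> norm (\<phi> \<xi>)"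
    using continuous_attains_sup[of "sphere (0 :: complex) R" "\<lambda>\<zeta>. norm (\<phi> \<zeta>)"] by auto
  have "norm (\<phi> (of_real (norm a))) \<le> norm (\<phi> \<xi>)"
  proof (rule maximum_modulus_frontier[of \<phi> "ball 0 R"])
    show "\<phi> holomorphic_on interior (ball 0 R)"
      by (rule holomorphic_on_subset[OF hol]) auto
    show "continuous_on (closure (ball 0 R)) \<phi>"
      by (rule continuous_on_subset[OF cont]) auto
    show "norm (\<phi> z) \<le> norm (\<phi> \<xi>)" if "z \<in> frontier (ball 0 R)" for z
      using that \<xi>(2) \<open>R > 0\<close> by (simp add: frontier_ball)
  qed (use a in auto)
  then have "norm (f a) \<le> norm (f (\<xi> *s v))"
    by (simp add: \<phi>_def av[symmetric])
  moreover have "norm (\<xi> *s v) = R"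
    using \<xi>(1) v by (simp add: norm_vector_scalar_mult)
  ultimately show thesis
    using that by blast
qed

text \<open>
  If \<open>|a| \<ge> 2\<close>, then \<open>1 + |a| \<le> 3|u|\<close> on the unit ball about \<open>a\<close>, and the weight can be moved into
  the integral.  The weight \<open>|u|\<^sup>m\<^sup>p\<close> vanishes at the origin, so for \<open>|a| < 2\<close> the point \<open>a\<close> is first
  replaced by a point \<open>b\<close> of the sphere \<open>|b| = 2\<close> with \<open>|f a| \<le> |f b|\<close>.  The radius \<open>5\<close> is chosen
  such that the unit ball about \<open>b\<close> still lies in the ball about \<open>a\<close>.
\<close>

lemma fock_pointwise_estimate:
  fixes \<alpha> p :: real and m :: nat
  assumes \<alpha>: "\<alpha> > 0" and p: "p > 0"
  shows "\<exists>K>0. \<forall>f a. line_holomorphic (f :: complex ^ 'n \<Rightarrow> complex) \<longrightarrow>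
     ennreal ((1 + norm a) powr (real m * p) * norm (f a) powr p * exp (- (\<alpha> * p / 2) * (norm a)\<^sup>2))
       \<le> ennreal K * (\<integral>\<^sup>+u\<in>ball a 5. ennreal ((norm u ^ m) powr p * norm (f u) powr p *
                        exp (- (\<alpha> * p / 2) * (norm u)\<^sup>2)) \<partial>lborel)"
proof -
  define c where "c = \<alpha> * p / 2"
  have c: "c > 0"
    using \<alpha> p by (simp add: c_def)
  obtain K where K: "K > 0" and est: "\<And>f a. line_holomorphic (f :: complex ^ 'n \<Rightarrow> complex) \<Longrightarrow>
     ennreal (norm (f a) powr p * exp (- c * (norm a)\<^sup>2))
       \<le> ennreal K * (\<integral>\<^sup>+u\<in>ball a 1. ennreal (norm (f u) powr p * exp (- c * (norm u)\<^sup>2)) \<partial>lborel)"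
    using fock_pointwise_estimate_unweighted[OF \<alpha> p, where 'n = 'n] unfolding c_def by blast
  define L where "L = exp (4 * c) * K * 3 powr (real m * p)"
  have "ennreal ((1 + norm a) powr (real m * p) * norm (f a) powr p * exp (- c * (norm a)\<^sup>2))
       \<le> ennreal L * (\<integral>\<^sup>+u\<in>ball a 5. ennreal ((norm u ^ m) powr p * norm (f u) powr p * exp (- c * (norm u)\<^sup>2)) \<partial>lborel)"
    if f: "line_holomorphic f" for f :: "complex ^ 'n \<Rightarrow> complex" and a
  proof -
    note [measurable] = line_holomorphic_measurable[OF f]
    have [measurable]: "ball x r \<in> sets borel" for x :: "complex ^ 'n" and r
      by simp
    define E where "E u = norm (f u) powr p * exp (- c * (norm u)\<^sup>2)" for u
    have E0: "E u \<ge> 0" for u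
      by (simp add: E_def)
    have [measurable]: "E \<in> borel_measurable borel"
      unfolding E_def by measurable
    define W where "W u = (norm u ^ m) powr p * E u" for u
    have [measurable]: "W \<in> borel_measurable borel"
      unfolding W_def by measurable
    have far: "ennreal ((1 + norm b) powr (real m * p) * E b)
        \<le> ennreal (K * 3 powr (real m * p)) * (\<integral>\<^sup>+u\<in>ball b 1. ennreal (W u) \<partial>lborel)" if b: "norm b \<ge> 2" for b
    proof -
      have le: "(1 + norm b) powr (real m * p) * E u \<le> 3 powr (real m * p) * W u" if u: "u \<in> ball b 1" for u
      proof -
        have "norm b \<le> norm u + dist b u"
          by (metis dist_norm norm_triangle_sub add.commute)
        then have u1: "norm u > 0" "1 + norm b \<le> 3 * norm u"
          using u b by auto
        have "(1 + norm b) powr (real m * p) \<le> (3 * norm u) powr (real m * p)"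
          using u1 p by (intro powr_mono2) auto
        also have "\<dots> = 3 powr (real m * p) * (norm u ^ m) powr p"
          using u1 by (simp add: powr_mult powr_powr powr_realpow[symmetric])
        finally show ?thesis
          unfolding W_def using E0[of u] by (simp add: mult_right_mono mult.assoc[symmetric])
      qed
      have "ennreal ((1 + norm b) powr (real m * p) * E b)
          = ennreal ((1 + norm b) powr (real m * p)) * ennreal (E b)"
        by (rule ennreal_mult') simp
      also have "\<dots> \<le> ennreal ((1 + norm b) powr (real m * p)) * (ennreal K * (\<integral>\<^sup>+u\<in>ball b 1. ennreal (E u) \<partial>lborel))"
        using est[OF f, of b] by (intro mult_left_mono) (auto simp: E_def)
      also have "\<dots> = ennreal K * (\<integral>\<^sup>+u. ennreal ((1 + norm b) powr (real m * p)) * (ennreal (E u) * indicator (ball b 1) u) \<partial>lborel)"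
        by (subst nn_integral_cmult) (auto simp: mult_ac)
      also have "(\<integral>\<^sup>+u. ennreal ((1 + norm b) powr (real m * p)) * (ennreal (E u) * indicator (ball b 1) u) \<partial>lborel)
          \<le> (\<integral>\<^sup>+u. ennreal (3 powr (real m * p)) * (ennreal (W u) * indicator (ball b 1) u) \<partial>lborel)"
      proof (rule nn_integral_mono)
        fix u
        show "ennreal ((1 + norm b) powr (real m * p)) * (ennreal (E u) * indicator (ball b 1) u)
            \<le> ennreal (3 powr (real m * p)) * (ennreal (W u) * indicator (ball b 1) u)"
          using le[of u] by (cases "u \<in> ball b 1") (auto simp: ennreal_mult'[symmetric] intro!: ennreal_leI)
      qed
      also have "\<dots> = ennreal (3 powr (real m * p)) * (\<integral>\<^sup>+u\<in>ball b 1. ennreal (W u) \<partial>lborel)"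
        by (rule nn_integral_cmult) measurable
      finally show ?thesis
        using K by (simp add: ennreal_mult' mult_left_mono mult.assoc)
    qed
    have ball_le: "(\<integral>\<^sup>+u\<in>ball b 1. ennreal (W u) \<partial>lborel) \<le> (\<integral>\<^sup>+u\<in>ball a 5. ennreal (W u) \<partial>lborel)"
      if "dist a b < 4" for b
    proof (rule nn_integral_mono)
      fix u
      have "u \<in> ball a 5" if "u \<in> ball b 1"
        using that \<open>dist a b < 4\<close> dist_triangle[of a u b] by auto
      then show "ennreal (W u) * indicator (ball b 1) u \<le> ennreal (W u) * indicator (ball a 5) u"
        by (auto simp: indicator_def)
    qed
    obtain b where b: "norm b \<ge> 2" "dist a b < 4"
        "(1 + norm a) powr (real m * p) * E a \<le> exp (4 * c) * ((1 + norm b) powr (real m * p) * E b)"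
    proof (cases "norm a \<ge> 2")
      case True
      have "1 * ((1 + norm a) powr (real m * p) * E a) \<le> exp (4 * c) * ((1 + norm a) powr (real m * p) * E a)"
        using c E0[of a] by (intro mult_right_mono) auto
      then show thesis
        using True by (intro that[of a]) auto
    next
      case False
      then obtain b where b: "norm b = 2" "norm (f a) \<le> norm (f b)"
        using line_holomorphic_max_on_sphere[OF f, of a 2] by auto
      have "dist a b \<le> norm a + norm b"
        by (simp add: dist_norm norm_triangle_ineq4)
      then have "dist a b < 4"
        using False b by simp
      moreover have "(1 + norm a) powr (real m * p) * E a \<le> (1 + norm b) powr (real m * p) * (norm (f b) powr p * 1)"
        unfolding E_def using False b p c by (intro mult_mono powr_mono2) auto
      moreover have "exp (4 * c) * ((1 + norm b) powr (real m * p) * E b) = (1 + norm b) powr (real m * p) * (norm (f b) powr p * 1)"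
        using b(1) by (simp add: E_def exp_minus field_simps)
      ultimately have "(1 + norm a) powr (real m * p) * E a \<le> exp (4 * c) * ((1 + norm b) powr (real m * p) * E b)"
        by (simp only:)
      with b \<open>dist a b < 4\<close> show thesis
        by (intro that[of b]) auto
    qed
    have "ennreal ((1 + norm a) powr (real m * p) * E a) \<le> ennreal (exp (4 * c) * ((1 + norm b) powr (real m * p) * E b))"
      using b(3) by (rule ennreal_leI)
    also have "\<dots> = ennreal (exp (4 * c)) * ennreal ((1 + norm b) powr (real m * p) * E b)"
      by (rule ennreal_mult') simp
    also have "\<dots> \<le> ennreal (exp (4 * c)) * (ennreal (K * 3 powr (real m * p)) * (\<integral>\<^sup>+u\<in>ball a 5. ennreal (W u) \<partial>lborel))"
      by (intro mult_left_mono order_trans[OF far[OF b(1)]] ball_le[OF b(2)]) auto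
    also have "\<dots> = ennreal L * (\<integral>\<^sup>+u\<in>ball a 5. ennreal (W u) \<partial>lborel)"
      using K by (simp add: L_def ennreal_mult' mult.assoc)
    finally show ?thesis
      by (simp add: E_def W_def mult.assoc)
  qed
  then show ?thesis
    using K by (intro exI[of _ L]) (auto simp: c_def L_def)
qed

section \<open>Averages and Berezin transforms as suprema\<close>

text \<open>
  For a lower semicontinuous function the set where it exceeds its essential supremum is open and null,
  hence empty.  This replaces the \<open>L\<^sup>\<infinity>\<close> norms below by pointwise suprema; both transforms are
  lower semicontinuous by Fatou's lemma, for every Borel measure \<open>\<mu>\<close>, finite or not.
\<close>

lemma Linf_norm_eq_SUP:
  fixes g :: "complex ^ 'n \<Rightarrow> ennreal"
  assumes lsc: "\<And>w x. w \<longlonglongrightarrow> x \<Longrightarrow> g x \<le> liminf (\<lambda>k. g (w k))"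
  shows "Linf_norm g = (SUP x. g x)"
proof -
  have closed: "closed {x. g x \<le> c}" for c
    unfolding closed_sequential_limits
  proof (intro allI impI, elim conjE)
    fix w :: "nat \<Rightarrow> complex ^ 'n" and x
    assume "\<forall>n. w n \<in> {x. g x \<le> c}" "w \<longlonglongrightarrow> x"
    then have "liminf (\<lambda>k. g (w k)) \<le> liminf (\<lambda>k. c)"
      by (intro Liminf_mono) auto
    then show "x \<in> {x. g x \<le> c}"
      using lsc[OF \<open>w \<longlonglongrightarrow> x\<close>] by (simp add: Liminf_const)
  qed
  have "{x. c < g x} = - {x. g x \<le> c}" for c
    by auto
  then have op: "open {x. c < g x}" for c
    using closed[of c] by (simp add: open_closed)
  have meas: "g \<in> borel_measurable lborel"
    by (rule borel_measurableI_greater) (use op in auto)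
  show ?thesis
  proof (rule antisym)
    show "Linf_norm g \<le> (SUP x. g x)"
      unfolding Linf_norm_def by (rule esssup_I[OF meas]) (auto intro: SUP_upper)
    show "(SUP x. g x) \<le> Linf_norm g"
    proof (rule SUP_least)
      fix x
      show "g x \<le> Linf_norm g"
      proof (rule ccontr)
        assume "\<not> g x \<le> Linf_norm g"
        then have x: "x \<in> {x. Linf_norm g < g x}"
          by simp
        then obtain e where e: "e > 0" "ball x e \<subseteq> {x. Linf_norm g < g x}"
          using op open_contains_ball by blast
        have "AE x in lborel. g x \<le> Linf_norm g"
          unfolding Linf_norm_def by (rule esssup_AE)
        then have "AE y in lborel. y \<notin> ball x e"
        proof (rule eventually_mono)
          fix y
          assume "g y \<le> Linf_norm g"
          then show "y \<notin> ball x e"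
            using e(2) by (auto simp: not_less[symmetric])
        qed
        then have "emeasure lborel (ball x e) = 0"
          by (subst (asm) AE_iff_null_sets[symmetric]) (auto simp: null_sets_def)
        then show False
          using emeasure_lborel_ball_pos[OF e(1), of x] by simp
      qed
    qed
  qed
qed

lemma berezin_lsc:
  assumes "sets \<mu> = sets borel" "w \<longlonglongrightarrow> x"
  shows "berezin \<alpha> t s \<mu> x \<le> liminf (\<lambda>k. berezin \<alpha> t s \<mu> (w k))"
proof -
  note [measurable_cong] = assms(1)
  let ?k = "\<lambda>w z. ennreal ((1 + norm z) powr (- s) * exp (- (t * \<alpha> / 2) * (norm (z - w))\<^sup>2))"
  have "berezin \<alpha> t s \<mu> x = (\<integral>\<^sup>+z. liminf (\<lambda>k. ?k (w k) z) \<partial>\<mu>)"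
    unfolding berezin_def
  proof (rule nn_integral_cong)
    fix z
    have "(\<lambda>k. ?k (w k) z) \<longlonglongrightarrow> ?k x z"
      by (intro tendsto_intros assms)
    then show "?k x z = liminf (\<lambda>k. ?k (w k) z)"
      by (rule lim_imp_Liminf[OF trivial_limit_sequentially, symmetric])
  qed
  also have "\<dots> \<le> liminf (\<lambda>k. berezin \<alpha> t s \<mu> (w k))"
    unfolding berezin_def by (rule nn_integral_liminf) measurable
  finally show ?thesis .
qed

lemma averaging_eq_nn_integral:
  assumes "sets \<mu> = sets borel"
  shows "averaging s r \<mu> w = (\<integral>\<^sup>+z. ennreal ((1 + norm w) powr (- s)) * indicator (ball w r) z \<partial>\<mu>)"
proof -
  have "1 + norm w > 0"
    by (simp add: add_pos_nonneg)
  then have "averaging s r \<mu> w = ennreal ((1 + norm w) powr (- s)) * emeasure \<mu> (ball w r)"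
    by (simp add: averaging_def divide_ennreal_def powr_minus inverse_ennreal mult.commute)
  also have "\<dots> = (\<integral>\<^sup>+z. ennreal ((1 + norm w) powr (- s)) * indicator (ball w r) z \<partial>\<mu>)"
    by (rule nn_integral_cmult_indicator[symmetric]) (simp add: assms)
  finally show ?thesis .
qed

text \<open>
  Because the balls are open, their indicator functions are lower semicontinuous in the centre.
\<close>

lemma averaging_lsc:
  assumes "sets \<mu> = sets borel" "w \<longlonglongrightarrow> x"
  shows "averaging s r \<mu> x \<le> liminf (\<lambda>k. averaging s r \<mu> (w k))"
proof -
  note [measurable_cong] = assms(1)
  have [measurable]: "ball y r \<in> sets borel" for y :: "complex ^ 'n"
    by simp
  let ?k = "\<lambda>w z. ennreal ((1 + norm w) powr (- s)) * indicator (ball w r) z"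
  have "averaging s r \<mu> x \<le> (\<integral>\<^sup>+z. liminf (\<lambda>k. ?k (w k) z) \<partial>\<mu>)"
    unfolding averaging_eq_nn_integral[OF assms(1)]
  proof (rule nn_integral_mono)
    fix z
    show "?k x z \<le> liminf (\<lambda>k. ?k (w k) z)"
    proof (cases "z \<in> ball x r")
      case True
      have "(\<lambda>k. dist (w k) z) \<longlonglongrightarrow> dist x z"
        by (intro tendsto_intros assms)
      then have "eventually (\<lambda>k. dist (w k) z < r) sequentially"
        using True by (intro order_tendstoD) auto
      then have ev: "eventually (\<lambda>k. ennreal ((1 + norm (w k)) powr (- s)) = ?k (w k) z) sequentially"
        by eventually_elim auto
      have "1 + norm x \<noteq> 0"
        using norm_ge_zero[of x] by linarith
      then have "(\<lambda>k. ennreal ((1 + norm (w k)) powr (- s))) \<longlonglongrightarrow> ennreal ((1 + norm x) powr (- s))"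
        by (intro tendsto_ennrealI tendsto_powr tendsto_add tendsto_norm tendsto_const assms)
      then have "(\<lambda>k. ?k (w k) z) \<longlonglongrightarrow> ennreal ((1 + norm x) powr (- s))"
        using ev by (rule Lim_transform_eventually)
      then show ?thesis
        using True by (simp add: lim_imp_Liminf)
    qed auto
  qed
  also have "\<dots> \<le> liminf (\<lambda>k. averaging s r \<mu> (w k))"
    unfolding averaging_eq_nn_integral[OF assms(1)] by (rule nn_integral_liminf) measurable
  finally show ?thesis .
qed

lemma Linf_norm_berezin:
  "sets \<mu> = sets borel \<Longrightarrow> Linf_norm (berezin \<alpha> t s \<mu>) = (SUP w. berezin \<alpha> t s \<mu> w)"
  by (rule Linf_norm_eq_SUP) (rule berezin_lsc)

lemma Linf_norm_averaging:
  "sets \<mu> = sets borel \<Longrightarrow> Linf_norm (averaging s r \<mu>) = (SUP w. averaging s r \<mu> w)"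
  by (rule Linf_norm_eq_SUP) (rule averaging_lsc)

section \<open>Integrating ball means against \<open>\<mu>\<close>\<close>

lemma one_plus_norm_le:
  fixes u z :: "'a::real_normed_vector"
  shows "1 + norm u \<le> (1 + dist u z) * (1 + norm z)"
proof -
  have "norm u \<le> dist u z + norm z"
    by (metis dist_norm norm_triangle_sub add.commute)
  moreover have "0 \<le> dist u z * norm z"
    by simp
  ultimately show ?thesis
    by (simp only: ring_distribs mult_1 mult_1_right)
qed

lemma one_plus_norm_powr_minus_le:
  fixes u z :: "'a::real_normed_vector"
  assumes "s \<ge> 0" "dist u z \<le> R"
  shows "(1 + norm z) powr (- s) \<le> (1 + R) powr s * (1 + norm u) powr (- s)"
proof -
  have pos: "1 + norm z > 0" "1 + norm u > 0"
    by (auto simp: add_pos_nonneg)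
  have "R \<ge> 0"
    using assms(2) zero_le_dist[of u z] by linarith
  have "1 + norm u \<le> (1 + R) * (1 + norm z)"
    using one_plus_norm_le[of u z] assms(2) pos by (meson mult_right_mono add_left_mono less_imp_le order_trans)
  then have "(1 + norm u) powr s \<le> ((1 + R) * (1 + norm z)) powr s"
    using assms pos by (intro powr_mono2) auto
  also have "\<dots> = (1 + R) powr s * (1 + norm z) powr s"
    using \<open>R \<ge> 0\<close> pos by (intro powr_mult) 
  finally show ?thesis
    using pos by (simp add: powr_minus field_simps)
qed

text \<open>
  Supplies the hypothesis of Fubini's theorem: countably many balls of radius \<open>R\<close> cover the space.
\<close>

lemma averaging_finite_sigma_finite:
  fixes \<mu> :: "(complex ^ 'n) measure"
  assumes sets: "sets \<mu> = sets borel" and R: "R > 0" and fin: "\<And>w. averaging s R \<mu> w < top"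
  shows "sigma_finite_measure \<mu>"
proof -
  obtain D :: "(complex ^ 'n) set" where D: "countable D" "\<And>X. open X \<Longrightarrow> X \<noteq> {} \<Longrightarrow> \<exists>d\<in>D. d \<in> X"
    by (rule countable_dense_setE) blast
  have "emeasure \<mu> (ball w R) \<noteq> top" for w
    using fin[of w] by (auto simp: averaging_def ennreal_top_divide split: if_splits)
  moreover have "(\<Union>w\<in>D. ball w R) = UNIV"
  proof -
    have "x \<in> (\<Union>w\<in>D. ball w R)" for x
      using D(2)[of "ball x R"] R by (auto simp: dist_commute)
    then show ?thesis by blast
  qed
  ultimately show ?thesis
    using D(1) sets by (intro sigma_finite_measure.intro exI[of _ "(\<lambda>w. ball w R) ` D"])
      (auto simp: sets_eq_imp_space_eq[OF sets])
qed

lemma borel_measurable_indicator_dist_less: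
  "(\<lambda>(z, u :: 'a::euclidean_space). indicator (ball z R) u :: ennreal) \<in> borel_measurable (borel \<Otimes>\<^sub>M borel)"
proof -
  define B where "B = {x :: 'a \<times> 'a. dist (fst x) (snd x) < R}"
  have "open B"
    unfolding B_def by (intro open_Collect_less continuous_intros)
  then have "B \<in> sets (borel \<Otimes>\<^sub>M borel)"
    unfolding borel_prod by simp
  moreover have "(\<lambda>(z, u). indicator (ball z R) u) = (indicator B :: _ \<Rightarrow> ennreal)"
    by (auto simp: B_def indicator_def)
  ultimately show ?thesis
    by simp
qed

lemma borel_measurable_ball_integral:
  fixes H :: "'a::euclidean_space \<Rightarrow> ennreal"
  assumes [measurable]: "H \<in> borel_measurable borel"
  shows "(\<lambda>z. \<integral>\<^sup>+u\<in>ball z R. H u \<partial>lborel) \<in> borel_measurable borel"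
proof -
  note [measurable] = borel_measurable_indicator_dist_less[where 'a = 'a and R = R, unfolded case_prod_beta']
  have "(\<lambda>x :: 'a \<times> 'a. H (snd x) * indicator (ball (fst x) R) (snd x)) \<in> borel_measurable (borel \<Otimes>\<^sub>M lborel)"
    by measurable
  from lborel.borel_measurable_nn_integral[of "\<lambda>z u. H u * indicator (ball z R) u", unfolded case_prod_beta', OF this]
  show ?thesis .
qed

text \<open>
  This lemma yields the upper bounds both for Berezin transforms and for Carleson embeddings: it
  applies whenever a function to be integrated against \<open>\<mu>\<close> is dominated pointwise by
  \<open>(1 + |z|)\<^bsup>-s\<^esup>\<close> times the integral of some \<open>H\<close> over the ball of radius \<open>R\<close> about \<open>z\<close>.
  Fubini's theorem moves the condition \<open>|z - u| < R\<close> to the integration in \<open>z\<close>, where it produces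
  the average of \<open>\<mu>\<close> at \<open>u\<close>.
\<close>

lemma nn_integral_ball_mean_le_averaging:
  fixes \<mu> :: "(complex ^ 'n) measure" and H :: "complex ^ 'n \<Rightarrow> ennreal"
  assumes sets: "sets \<mu> = sets borel" and R: "R > 0" and s: "s \<ge> 0"
    and H [measurable]: "H \<in> borel_measurable borel"
    and S: "\<And>w. averaging s R \<mu> w \<le> S" "S < top"
  shows "(\<integral>\<^sup>+z. ennreal ((1 + norm z) powr (- s)) * (\<integral>\<^sup>+u\<in>ball z R. H u \<partial>lborel) \<partial>\<mu>)
       \<le> ennreal ((1 + R) powr s) * S * (\<integral>\<^sup>+u. H u \<partial>lborel)"
proof -
  note [measurable_cong] = sets
  have "averaging s R \<mu> w < top" for w
    using S by (rule le_less_trans)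
  then interpret sigma_finite_measure \<mu>
    using averaging_finite_sigma_finite[OF sets R] by blast
  interpret pair_sigma_finite \<mu> lborel ..
  define k where "k z = ennreal ((1 + norm z) powr (- s))" for z :: "complex ^ 'n"
  have [measurable]: "k \<in> borel_measurable borel"
    unfolding k_def by measurable
  note [measurable] = borel_measurable_indicator_dist_less[where 'a = "complex ^ 'n" and R = R, unfolded case_prod_beta']
  have [measurable]: "ball u R \<in> sets borel" for u :: "complex ^ 'n"
    by simp
  have [measurable]: "(\<lambda>z. indicator (ball z R) u :: ennreal) \<in> borel_measurable borel" for u :: "complex ^ 'n"
  proof -
    have "indicator (ball z R) u = (indicator (ball u R) z :: ennreal)" for z
      by (simp add: indicator_def dist_commute)
    then show ?thesis
      by simp
  qed
  have inner: "(\<integral>\<^sup>+z. k z * indicator (ball z R) u \<partial>\<mu>) \<le> ennreal ((1 + R) powr s) * S" for u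
  proof -
    have "(\<integral>\<^sup>+z. k z * indicator (ball z R) u \<partial>\<mu>)
       \<le> (\<integral>\<^sup>+z. ennreal ((1 + R) powr s) * (ennreal ((1 + norm u) powr (- s)) * indicator (ball u R) z) \<partial>\<mu>)"
    proof (rule nn_integral_mono)
      fix z
      show "k z * indicator (ball z R) u \<le> ennreal ((1 + R) powr s) * (ennreal ((1 + norm u) powr (- s)) * indicator (ball u R) z)"
        using one_plus_norm_powr_minus_le[OF s, of u z R]
        by (auto simp: k_def indicator_def dist_commute ennreal_mult'[symmetric] intro!: ennreal_leI)
    qed
    also have "\<dots> = ennreal ((1 + R) powr s) * averaging s R \<mu> u"
      unfolding averaging_eq_nn_integral[OF sets] by (rule nn_integral_cmult) measurable
    also have "\<dots> \<le> ennreal ((1 + R) powr s) * S"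
      by (intro mult_left_mono S) simp
    finally show ?thesis .
  qed
  have "(\<integral>\<^sup>+z. k z * (\<integral>\<^sup>+u\<in>ball z R. H u \<partial>lborel) \<partial>\<mu>)
      = (\<integral>\<^sup>+z. (\<integral>\<^sup>+u. k z * (H u * indicator (ball z R) u) \<partial>lborel) \<partial>\<mu>)"
    by (intro nn_integral_cong nn_integral_cmult[symmetric]) measurable
  also have "\<dots> = (\<integral>\<^sup>+u. (\<integral>\<^sup>+z. k z * (H u * indicator (ball z R) u) \<partial>\<mu>) \<partial>lborel)"
    by (rule Fubini'[symmetric]) measurable
  also have "\<dots> = (\<integral>\<^sup>+u. H u * (\<integral>\<^sup>+z. k z * indicator (ball z R) u \<partial>\<mu>) \<partial>lborel)"
    by (intro nn_integral_cong, subst nn_integral_cmult[symmetric]) (auto simp: mult_ac)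
  also have "\<dots> \<le> (\<integral>\<^sup>+u. H u * (ennreal ((1 + R) powr s) * S) \<partial>lborel)"
    by (intro nn_integral_mono mult_left_mono inner) auto
  also have "\<dots> = ennreal ((1 + R) powr s) * S * (\<integral>\<^sup>+u. H u \<partial>lborel)"
    by (subst nn_integral_multc) (auto simp: mult_ac)
  finally show ?thesis
    by (simp add: k_def)
qed

section \<open>Gaussian integrals\<close>

lemma nn_integral_gaussian_finite:
  fixes c :: real
  assumes c: "c > 0"
  shows "(\<integral>\<^sup>+x. ennreal (exp (- c * (norm (x :: 'a::euclidean_space))\<^sup>2)) \<partial>lborel) < top"
proof -
  define \<sigma> where "\<sigma> = 1 / sqrt (2 * c)"
  have \<sigma>: "\<sigma> > 0" "\<sigma>\<^sup>2 = 1 / (2 * c)"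
    using c by (auto simp: \<sigma>_def power_divide)
  have "exp (- c * x\<^sup>2) = sqrt (2 * pi * \<sigma>\<^sup>2) * normal_density 0 \<sigma> x" for x
    using \<sigma> c by (simp add: normal_density_def)
  moreover have "integrable lborel (\<lambda>x. sqrt (2 * pi * \<sigma>\<^sup>2) * normal_density 0 \<sigma> x)"
    using \<sigma> by (intro integrable_mult_right integrable_normal_density)
  ultimately have "integrable lborel (\<lambda>x. exp (- c * x\<^sup>2))"
    by simp
  then have one: "(\<integral>\<^sup>+x. ennreal (exp (- c * x\<^sup>2)) \<partial>lborel) < top"
    by (simp add: nn_integral_eq_integral)
  have "ennreal (exp (- c * (norm x)\<^sup>2)) = (\<Prod>b\<in>Basis. ennreal (exp (- c * (x \<bullet> b)\<^sup>2)))" for x :: 'a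
  proof -
    have "(norm x)\<^sup>2 = (\<Sum>b\<in>Basis. (x \<bullet> b)\<^sup>2)"
      unfolding power2_norm_eq_inner euclidean_inner[of x x] by (simp add: power2_eq_square)
    then show ?thesis
      by (simp add: prod_ennreal sum_distrib_left exp_sum[symmetric] sum_negf)
  qed
  then have "(\<integral>\<^sup>+x. ennreal (exp (- c * (norm (x :: 'a))\<^sup>2)) \<partial>lborel)
      = (\<Prod>b\<in>(Basis :: 'a set). (\<integral>\<^sup>+x. ennreal (exp (- c * x\<^sup>2)) \<partial>lborel))"
    using nn_integral_lborel_prod[where f = "\<lambda>(b :: 'a) x. ennreal (exp (- c * x\<^sup>2))"] by simp
  also have "\<dots> < top"
    using one by (simp add: power_less_top_ennreal)
  finally show ?thesis .
qed

lemma nn_integral_gaussian_moment_finite: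
  fixes c a :: real
  assumes c: "c > 0" and a: "a \<ge> 0"
  shows "(\<integral>\<^sup>+x. ennreal ((1 + norm x) powr a * exp (- c * (norm (x :: 'a::euclidean_space))\<^sup>2)) \<partial>lborel) < top"
proof -
  have le: "(1 + r) powr a * exp (- c * r\<^sup>2) \<le> exp (a\<^sup>2 / (2 * c)) * exp (- (c / 2) * r\<^sup>2)" if "r \<ge> 0" for r :: real
  proof -
    have "(1 + r) powr a \<le> exp r powr a"
      using that a exp_ge_add_one_self[of r] by (intro powr_mono2) auto
    also have "\<dots> = exp (a * r)"
      by (simp add: exp_powr_real mult.commute)
    finally have "(1 + r) powr a * exp (- c * r\<^sup>2) \<le> exp (a * r) * exp (- c * r\<^sup>2)"
      by (rule mult_right_mono) simp
    also have "\<dots> = exp (a * r - c * r\<^sup>2)"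
      by (simp add: exp_add[symmetric])
    also have "a * r - c * r\<^sup>2 = a\<^sup>2 / (2 * c) - (c / 2) * r\<^sup>2 - (c * r - a)\<^sup>2 / (2 * c)"
      using c by (simp add: field_simps power2_eq_square)
    also have "\<dots> \<le> a\<^sup>2 / (2 * c) + - (c / 2) * r\<^sup>2"
      using c by simp
    finally show ?thesis
      by (simp add: exp_add[symmetric])
  qed
  have "(\<integral>\<^sup>+x. ennreal ((1 + norm x) powr a * exp (- c * (norm (x :: 'a))\<^sup>2)) \<partial>lborel)
      \<le> (\<integral>\<^sup>+x. ennreal (exp (a\<^sup>2 / (2 * c))) * ennreal (exp (- (c / 2) * (norm (x :: 'a))\<^sup>2)) \<partial>lborel)"
    using le by (intro nn_integral_mono) (auto simp: ennreal_mult'[symmetric] simp del: mult_minus_left intro!: ennreal_leI)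
  also have "\<dots> = ennreal (exp (a\<^sup>2 / (2 * c))) * (\<integral>\<^sup>+x. ennreal (exp (- (c / 2) * (norm (x :: 'a))\<^sup>2)) \<partial>lborel)"
    by (rule nn_integral_cmult) measurable
  also have "\<dots> < top"
    using nn_integral_gaussian_finite[of "c / 2", where 'a = 'a] c by (simp add: ennreal_mult_less_top)
  finally show ?thesis .
qed

section \<open>Comparison of averages and Berezin transforms\<close>

text \<open>
  One half of \<^const>\<open>comparable\<close>.  Unlike the latter it can be composed along the cycle of implications
  one direction at a time.
\<close>

definition dominated ::
    "((complex ^ 'n) measure \<Rightarrow> ennreal) \<Rightarrow> ((complex ^ 'n) measure \<Rightarrow> ennreal) \<Rightarrow> bool" where
  "dominated U V \<longleftrightarrow> (\<exists>C>0. \<forall>\<mu>. sets \<mu> = sets borel \<longrightarrow> U \<mu> \<le> ennreal C * V \<mu>)"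

lemma dominated_trans:
  assumes "dominated U V" "dominated V W"
  shows "dominated U W"
proof -
  obtain C D where C: "C > 0" "\<And>\<mu>. sets \<mu> = sets borel \<Longrightarrow> U \<mu> \<le> ennreal C * V \<mu>"
    and D: "D > 0" "\<And>\<mu>. sets \<mu> = sets borel \<Longrightarrow> V \<mu> \<le> ennreal D * W \<mu>"
    using assms unfolding dominated_def by blast
  have "U \<mu> \<le> ennreal (C * D) * W \<mu>" if "sets \<mu> = sets borel" for \<mu>
  proof -
    have "U \<mu> \<le> ennreal C * (ennreal D * W \<mu>)"
      using C(2)[OF that] D(2)[OF that] by (meson mult_left_mono order_trans zero_le)
    then show ?thesis
      using C(1) by (simp add: ennreal_mult' mult.assoc)
  qed
  then show ?thesis
    unfolding dominated_def using C(1) D(1) by (intro exI[of _ "C * D"]) auto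
qed

lemma dominated_imp_comparable:
  assumes "dominated U V" "dominated V U"
  shows "comparable U V"
proof -
  obtain C D where C: "C > 0" "\<And>\<mu>. sets \<mu> = sets borel \<Longrightarrow> U \<mu> \<le> ennreal C * V \<mu>"
    and D: "D > 0" "\<And>\<mu>. sets \<mu> = sets borel \<Longrightarrow> V \<mu> \<le> ennreal D * U \<mu>"
    using assms unfolding dominated_def by blast
  have "U \<mu> \<le> ennreal (max C D) * V \<mu> \<and> V \<mu> \<le> ennreal (max C D) * U \<mu>" if "sets \<mu> = sets borel" for \<mu>
  proof -
    have "ennreal C * V \<mu> \<le> ennreal (max C D) * V \<mu>" "ennreal D * U \<mu> \<le> ennreal (max C D) * U \<mu>"
      by (intro mult_right_mono ennreal_leI; simp)+
    then show ?thesis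
      using C(2)[OF that] D(2)[OF that] by (meson order_trans)
  qed
  then show ?thesis
    unfolding comparable_def using C(1) by (intro exI[of _ "max C D"]) auto
qed

lemma dominated_finite:
  assumes "dominated U V" "sets \<mu> = sets borel" "V \<mu> < top"
  shows "U \<mu> < top"
proof -
  obtain C where "U \<mu> \<le> ennreal C * V \<mu>"
    using assms unfolding dominated_def by blast
  also have "\<dots> < top"
    using assms(3) by (simp add: ennreal_mult_less_top)
  finally show ?thesis .
qed

text \<open>
  On the ball of radius \<open>r\<close> about \<open>w\<close> the Gaussian is bounded below and \<open>1 + |z|\<close> is comparable to \<open>1 + |w|\<close>.
\<close>

lemma averaging_dominated_berezin:
  assumes "s \<ge> 0" "r > 0"
  shows "dominated (\<lambda>\<mu> :: (complex ^ 'n) measure. Linf_norm (averaging s r \<mu>)) (\<lambda>\<mu>. Linf_norm (berezin \<alpha> t s \<mu>))"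
  unfolding dominated_def
proof (intro exI conjI allI impI)
  define c where "c = t * \<alpha> / 2"
  define C where "C = (1 + r) powr s * exp (\<bar>c\<bar> * r\<^sup>2)"
  show C: "C > 0"
    using assms by (simp add: C_def)
  fix \<mu> :: "(complex ^ 'n) measure"
  assume sets: "sets \<mu> = sets borel"
  note [measurable_cong] = sets
  have [measurable]: "ball y r \<in> sets borel" for y :: "complex ^ 'n"
    by simp
  have "averaging s r \<mu> w \<le> ennreal C * Linf_norm (berezin \<alpha> t s \<mu>)" for w
  proof -
    have "averaging s r \<mu> w \<le> (\<integral>\<^sup>+z. ennreal C * ennreal ((1 + norm z) powr (- s) * exp (- c * (norm (z - w))\<^sup>2)) \<partial>\<mu>)"
      unfolding averaging_eq_nn_integral[OF sets]
    proof (rule nn_integral_mono)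
      fix z
      have "(1 + norm w) powr (- s) \<le> C * ((1 + norm z) powr (- s) * exp (- c * (norm (z - w))\<^sup>2))" if "z \<in> ball w r"
      proof -
        have d: "dist z w \<le> r"
          using that by (simp add: dist_commute)
        have "c * (norm (z - w))\<^sup>2 \<le> \<bar>c\<bar> * r\<^sup>2"
          using d by (intro mult_mono power_mono) (auto simp: dist_norm)
        then have "1 \<le> exp (\<bar>c\<bar> * r\<^sup>2) * exp (- c * (norm (z - w))\<^sup>2)"
          by (simp add: exp_add[symmetric])
        then have "(1 + norm w) powr (- s) * 1 \<le> ((1 + r) powr s * (1 + norm z) powr (- s)) * (exp (\<bar>c\<bar> * r\<^sup>2) * exp (- c * (norm (z - w))\<^sup>2))"
          using one_plus_norm_powr_minus_le[OF assms(1) d] by (intro mult_mono) auto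
        then show ?thesis
          by (simp add: C_def mult_ac)
      qed
      then show "ennreal ((1 + norm w) powr (- s)) * indicator (ball w r) z
          \<le> ennreal C * ennreal ((1 + norm z) powr (- s) * exp (- c * (norm (z - w))\<^sup>2))"
        using C by (cases "z \<in> ball w r") (auto simp: ennreal_mult'[symmetric] intro!: ennreal_leI)
    qed
    also have "\<dots> = ennreal C * berezin \<alpha> t s \<mu> w"
      unfolding berezin_def c_def by (rule nn_integral_cmult) measurable
    also have "\<dots> \<le> ennreal C * Linf_norm (berezin \<alpha> t s \<mu>)"
      unfolding Linf_norm_berezin[OF sets] by (intro mult_left_mono SUP_upper) auto
    finally show ?thesis .
  qed
  then show "Linf_norm (averaging s r \<mu>) \<le> ennreal C * Linf_norm (berezin \<alpha> t s \<mu>)"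
    unfolding Linf_norm_averaging[OF sets] by (rule SUP_least)
qed

text \<open>
  Since \<open>|u - w|\<^sup>2 \<le> 2|u - z|\<^sup>2 + 2|z - w|\<^sup>2\<close>, a Gaussian of half the exponent, integrated over a ball about
  \<open>z\<close>, dominates the value at \<open>z\<close>.
\<close>

lemma gaussian_le_ball_integral:
  fixes z w :: "'a::euclidean_space"
  assumes c: "c \<ge> 0" and r: "r > 0"
  shows "ennreal (exp (- (2 * c) * (norm (z - w))\<^sup>2))
      \<le> ennreal (exp (2 * c * r\<^sup>2) / measure lborel (ball (0 :: 'a) r))
         * (\<integral>\<^sup>+u\<in>ball z r. ennreal (exp (- c * (norm (u - w))\<^sup>2)) \<partial>lborel)"
proof -
  define V where "V = measure lborel (ball (0 :: 'a) r)"
  have V: "emeasure lborel (ball z r) = ennreal V" for z :: 'a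
    using r by (simp add: V_def emeasure_ball content_ball)
  have V0: "V > 0"
    using emeasure_lborel_ball_pos[OF r, of "0 :: 'a"] unfolding V by simp
  have [measurable]: "ball z r \<in> sets borel"
    by simp
  have "ennreal (exp (- (2 * c) * (norm (z - w))\<^sup>2)) * ennreal V
      = (\<integral>\<^sup>+u. ennreal (exp (- (2 * c) * (norm (z - w))\<^sup>2)) * indicator (ball z r) u \<partial>lborel)"
    by (simp add: nn_integral_cmult_indicator V)
  also have "\<dots> \<le> (\<integral>\<^sup>+u. ennreal (exp (2 * c * r\<^sup>2)) * (ennreal (exp (- c * (norm (u - w))\<^sup>2)) * indicator (ball z r) u) \<partial>lborel)"
  proof (rule nn_integral_mono)
    fix u
    have "exp (- (2 * c) * (norm (z - w))\<^sup>2) \<le> exp (2 * c * r\<^sup>2) * exp (- c * (norm (u - w))\<^sup>2)" if u: "u \<in> ball z r"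
    proof -
      have "norm (u - w) \<le> norm (u - z) + norm (z - w)"
        using norm_triangle_ineq[of "u - z" "z - w"] by simp
      then have "(norm (u - w))\<^sup>2 \<le> (norm (u - z) + norm (z - w))\<^sup>2"
        by (intro power_mono) auto
      also have "\<dots> \<le> 2 * (norm (u - z))\<^sup>2 + 2 * (norm (z - w))\<^sup>2"
        using sum_squares_bound[of "norm (u - z)" "norm (z - w)"] by (simp add: power2_sum)
      also have "\<dots> \<le> 2 * r\<^sup>2 + 2 * (norm (z - w))\<^sup>2"
        using u r by (auto simp: dist_norm norm_minus_commute intro!: power_mono)
      finally have "c * (norm (u - w))\<^sup>2 \<le> c * (2 * r\<^sup>2 + 2 * (norm (z - w))\<^sup>2)"
        using c by (rule mult_left_mono)
      then show ?thesis
        by (simp add: exp_add[symmetric] algebra_simps)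
    qed
    then show "ennreal (exp (- (2 * c) * (norm (z - w))\<^sup>2)) * indicator (ball z r) u
        \<le> ennreal (exp (2 * c * r\<^sup>2)) * (ennreal (exp (- c * (norm (u - w))\<^sup>2)) * indicator (ball z r) u)"
      by (cases "u \<in> ball z r") (auto simp: ennreal_mult'[symmetric] intro!: ennreal_leI)
  qed
  also have "\<dots> = ennreal (exp (2 * c * r\<^sup>2)) * (\<integral>\<^sup>+u\<in>ball z r. ennreal (exp (- c * (norm (u - w))\<^sup>2)) \<partial>lborel)"
    by (rule nn_integral_cmult) measurable
  finally have *: "ennreal (exp (- (2 * c) * (norm (z - w))\<^sup>2)) * ennreal V \<le> \<dots>" .
  have "ennreal (exp (- (2 * c) * (norm (z - w))\<^sup>2))
      = ennreal (1 / V) * (ennreal (exp (- (2 * c) * (norm (z - w))\<^sup>2)) * ennreal V)"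
    using V0 by (simp add: ennreal_mult'[symmetric])
  also have "\<dots> \<le> ennreal (1 / V) * (ennreal (exp (2 * c * r\<^sup>2)) * (\<integral>\<^sup>+u\<in>ball z r. ennreal (exp (- c * (norm (u - w))\<^sup>2)) \<partial>lborel))"
    using * by (rule mult_left_mono) simp
  also have "\<dots> = ennreal (exp (2 * c * r\<^sup>2) / V) * (\<integral>\<^sup>+u\<in>ball z r. ennreal (exp (- c * (norm (u - w))\<^sup>2)) \<partial>lborel)"
    using V0 by (simp add: mult.assoc[symmetric] ennreal_mult'[symmetric])
  finally show ?thesis
    by (simp add: V_def)
qed

text \<open>
  The radius \<open>r\<close> is arbitrary here, so together with the previous direction this also compares averages
  over balls of different radii, through the Berezin transform.
\<close>

lemma berezin_dominated_averaging:
  assumes \<alpha>: "\<alpha> > 0" and t: "t > 0" and s: "s \<ge> 0" and r: "r > 0"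
  shows "dominated (\<lambda>\<mu> :: (complex ^ 'n) measure. Linf_norm (berezin \<alpha> t s \<mu>)) (\<lambda>\<mu>. Linf_norm (averaging s r \<mu>))"
proof -
  define c where "c = t * \<alpha> / 4"
  have c: "c > 0"
    using \<alpha> t by (simp add: c_def)
  define H where "H w u = ennreal (exp (- c * (norm (u - w))\<^sup>2))" for w u :: "complex ^ 'n"
  have [measurable]: "H w \<in> borel_measurable borel" for w
    unfolding H_def by measurable
  have "(\<integral>\<^sup>+u. H w u \<partial>lborel) = (\<integral>\<^sup>+u. H 0 u \<partial>lborel)" for w
    using nn_integral_lborel_translate[of "H w" w] by (simp add: H_def)
  moreover obtain G where G: "(\<integral>\<^sup>+u. H 0 u \<partial>lborel) = ennreal G" "G \<ge> 0"
    using nn_integral_gaussian_finite[OF c, where 'a = "complex ^ 'n"] unfolding H_def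
    by (cases "\<integral>\<^sup>+u. ennreal (exp (- c * (norm (u :: complex ^ 'n))\<^sup>2)) \<partial>lborel") auto
  ultimately have Hint: "(\<integral>\<^sup>+u. H w u \<partial>lborel) = ennreal G" for w
    by simp
  obtain Q where Q: "Q \<ge> 0" "\<And>z w :: complex ^ 'n. ennreal (exp (- (2 * c) * (norm (z - w))\<^sup>2))
      \<le> ennreal Q * (\<integral>\<^sup>+u\<in>ball z r. H w u \<partial>lborel)"
    using gaussian_le_ball_integral[of c r, where 'a = "complex ^ 'n"] c r unfolding H_def
    by (meson divide_nonneg_nonneg exp_ge_zero less_imp_le measure_nonneg)
  \<comment> \<open>The summand \<open>1\<close> makes \<open>C\<close> positive, so that the right-hand side is infinite when the averages are unbounded.\<close>
  define C where "C = Q * (1 + r) powr s * G + 1"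
  have C: "C > 0"
    using Q G by (simp add: C_def add_nonneg_pos)
  have "Linf_norm (berezin \<alpha> t s \<mu>) \<le> ennreal C * Linf_norm (averaging s r \<mu>)"
    if sets: "sets \<mu> = sets borel" for \<mu> :: "(complex ^ 'n) measure"
  proof (cases "Linf_norm (averaging s r \<mu>) = top")
    case True
    then show ?thesis
      using C by (simp add: ennreal_mult_top)
  next
    case False
    note [measurable_cong] = sets
    let ?S = "Linf_norm (averaging s r \<mu>)"
    have S: "averaging s r \<mu> w \<le> ?S" for w
      unfolding Linf_norm_averaging[OF sets] by (rule SUP_upper) simp
    have "berezin \<alpha> t s \<mu> w \<le> ennreal C * ?S" for w
    proof -
      have "(\<lambda>z. \<integral>\<^sup>+u\<in>ball z r. H w u \<partial>lborel) \<in> borel_measurable borel"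
        by (rule borel_measurable_ball_integral) measurable
      note [measurable] = this
      have "berezin \<alpha> t s \<mu> w
          \<le> (\<integral>\<^sup>+z. ennreal Q * (ennreal ((1 + norm z) powr (- s)) * (\<integral>\<^sup>+u\<in>ball z r. H w u \<partial>lborel)) \<partial>\<mu>)"
        unfolding berezin_def
      proof (rule nn_integral_mono)
        fix z
        have "ennreal ((1 + norm z) powr (- s) * exp (- (t * \<alpha> / 2) * (norm (z - w))\<^sup>2))
          = ennreal ((1 + norm z) powr (- s)) * ennreal (exp (- (2 * c) * (norm (z - w))\<^sup>2))"
          by (simp add: ennreal_mult' c_def mult_ac)
        also have "\<dots> \<le> ennreal ((1 + norm z) powr (- s)) * (ennreal Q * (\<integral>\<^sup>+u\<in>ball z r. H w u \<partial>lborel))"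
          by (intro mult_left_mono Q) simp
        finally show "ennreal ((1 + norm z) powr (- s) * exp (- (t * \<alpha> / 2) * (norm (z - w))\<^sup>2))
          \<le> ennreal Q * (ennreal ((1 + norm z) powr (- s)) * (\<integral>\<^sup>+u\<in>ball z r. H w u \<partial>lborel))"
          by (simp add: mult_ac)
      qed
      also have "\<dots> = ennreal Q * (\<integral>\<^sup>+z. ennreal ((1 + norm z) powr (- s)) * (\<integral>\<^sup>+u\<in>ball z r. H w u \<partial>lborel) \<partial>\<mu>)"
        by (rule nn_integral_cmult) measurable
      also have "\<dots> \<le> ennreal Q * (ennreal ((1 + r) powr s) * ?S * (\<integral>\<^sup>+u. H w u \<partial>lborel))"
        using False by (intro mult_left_mono nn_integral_ball_mean_le_averaging sets r s S) (auto simp: top.not_eq_extremum)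
      also have "\<dots> = ennreal (Q * (1 + r) powr s * G) * ?S"
        using Q G by (simp add: Hint ennreal_mult' mult_ac)
      also have "\<dots> \<le> ennreal C * ?S"
        by (intro mult_right_mono ennreal_leI) (auto simp: C_def)
      finally show ?thesis .
    qed
    then show ?thesis
      unfolding Linf_norm_berezin[OF sets] by (rule SUP_least)
  qed
  then show ?thesis
    unfolding dominated_def using C by blast
qed

section \<open>Lattices\<close>

text \<open>
  A maximal \<open>r\<close>-separated set: maximality makes the balls of radius \<open>r\<close> cover, separation makes those of
  radius \<open>r/2\<close> disjoint.  Disjoint open balls are countably many, and infinitely many are needed because
  finitely many balls cannot cover an unbounded space.
\<close>

lemma half_lattice_exists:
  assumes r: "r > 0"
  shows "\<exists>z :: nat \<Rightarrow> complex ^ 'n. half_lattice r z"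
proof -
  define sep where "sep = {X :: (complex ^ 'n) set. \<forall>x\<in>X. \<forall>y\<in>X. x \<noteq> y \<longrightarrow> r \<le> dist x y}"
  have "\<forall>C\<in>chains sep. \<Union>C \<in> sep"
  proof
    fix C assume C: "C \<in> chains sep"
    show "\<Union>C \<in> sep"
      unfolding sep_def
    proof (intro CollectI ballI impI)
      fix x y assume "x \<in> \<Union>C" "y \<in> \<Union>C" "x \<noteq> y"
      then obtain X Y where XY: "X \<in> C" "Y \<in> C" "x \<in> X" "y \<in> Y"
        by blast
      then have "X \<subseteq> Y \<or> Y \<subseteq> X" "X \<in> sep" "Y \<in> sep"
        using C by (auto simp: chains_def chain_subset_def)
      then show "r \<le> dist x y"
        using XY \<open>x \<noteq> y\<close> unfolding sep_def by blast
    qed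
  qed
  from Zorn_Lemma[OF this] obtain M where M: "M \<in> sep" "\<And>X. X \<in> sep \<Longrightarrow> M \<subseteq> X \<Longrightarrow> X = M"
    by blast
  have sepM: "r \<le> dist x y" if "x \<in> M" "y \<in> M" "x \<noteq> y" for x y
    using M(1) that unfolding sep_def by blast
  have cover: "(\<Union>x\<in>M. ball x r) = UNIV"
  proof (rule ccontr)
    assume "(\<Union>x\<in>M. ball x r) \<noteq> UNIV"
    then obtain y where y: "y \<notin> (\<Union>x\<in>M. ball x r)"
      by blast
    then have far: "r \<le> dist x y" if "x \<in> M" for x
      using that by (auto simp: not_less)
    then have "insert y M \<in> sep"
      using sepM unfolding sep_def by (auto simp: dist_commute)
    then have "y \<in> M"
      using M(2)[of "insert y M"] by blast
    then show False
      using far[of y] r by simp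
  qed
  have disj: "ball x (r / 2) \<inter> ball y (r / 2) = {}" if "x \<in> M" "y \<in> M" "x \<noteq> y" for x y
    using sepM[OF that] by (intro disjoint_ballI) simp
  have "inj_on (\<lambda>x. ball x (r / 2)) M"
  proof (rule inj_onI)
    fix x y assume xy: "x \<in> M" "y \<in> M" "ball x (r / 2) = ball y (r / 2)"
    have "x \<in> ball x (r / 2)"
      using r by simp
    then show "x = y"
      using disj[of x y] xy by blast
  qed
  moreover have "countable ((\<lambda>x. ball x (r / 2)) ` M)"
  proof (rule countable_disjoint_open_subsets)
    show "pairwise disjnt ((\<lambda>x. ball x (r / 2)) ` M)"
    proof (rule pairwiseI)
      fix A B assume "A \<in> (\<lambda>x. ball x (r / 2)) ` M" "B \<in> (\<lambda>x. ball x (r / 2)) ` M" "A \<noteq> B"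
      then obtain x y where "x \<in> M" "y \<in> M" "A = ball x (r / 2)" "B = ball y (r / 2)" "x \<noteq> y"
        by blast
      then show "disjnt A B"
        unfolding disjnt_def using disj by simp
    qed
  qed auto
  ultimately have "countable M"
    using countable_image_inj_on by blast
  moreover have "infinite M"
  proof
    assume "finite M"
    then have "bounded (\<Union>x\<in>M. ball x r)"
      by (intro bounded_UN) auto
    then show False
      unfolding cover by simp
  qed
  ultimately obtain z :: "nat \<Rightarrow> complex ^ 'n" where "bij_betw z UNIV M"
    using bij_betw_from_nat_into by blast
  then have inj: "inj z" and range: "range z = M"
    by (auto simp: bij_betw_def)
  have zM: "z k \<in> M" for k
    using range by blast
  have "disjoint_family (\<lambda>k. ball (z k) (r / 2))"
    unfolding disjoint_family_on_def
  proof (intro ballI impI)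
    fix i j :: nat assume "i \<noteq> j"
    then have "z i \<noteq> z j"
      using inj by (simp add: inj_eq)
    then show "ball (z i) (r / 2) \<inter> ball (z j) (r / 2) = {}"
      by (intro disj zM)
  qed
  moreover have "(\<Union>k. ball (z k) r) = UNIV"
    using cover range by blast
  ultimately show ?thesis
    unfolding half_lattice_def using inj by blast
qed

text \<open>
  The half-radius balls about the lattice points counted here are disjoint and lie in the ball of radius
  \<open>5r/2\<close> about \<open>w\<close>; compare volumes.
\<close>

lemma half_lattice_multiplicity:
  fixes z :: "nat \<Rightarrow> complex ^ 'n"
  assumes r: "r > 0" and z: "half_lattice r z"
  shows "(\<Sum>k. indicator {k. dist w (z k) < 2 * r} k) \<le> ennreal (5 ^ DIM(complex ^ 'n))"
proof -
  let ?J = "{k. dist w (z k) < 2 * r}"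
  define V where "V = emeasure lborel (ball (0 :: complex ^ 'n) (r / 2))"
  have V: "emeasure lborel (ball x (r / 2)) = V" for x :: "complex ^ 'n"
    using r by (simp add: V_def emeasure_ball)
  have V0: "V \<noteq> 0" "V \<noteq> top"
    using emeasure_lborel_ball_pos[of "r / 2" "0 :: complex ^ 'n"] r unfolding V_def
    using emeasure_lborel_ball_finite[of "0 :: complex ^ 'n" "r / 2"] by auto
  define A where "A k = (if k \<in> ?J then ball (z k) (r / 2) else {})" for k
  have "disjoint_family A"
    using z unfolding half_lattice_def disjoint_family_on_def A_def by auto
  moreover have "range A \<subseteq> sets lborel"
    by (auto simp: A_def)
  ultimately have sum: "(\<Sum>k. emeasure lborel (A k)) = emeasure lborel (\<Union>k. A k)"
    by (intro suminf_emeasure)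
  have "V * (\<Sum>k. indicator ?J k) = (\<Sum>k. V * indicator ?J k)"
    by simp
  also have "\<dots> = (\<Sum>k. emeasure lborel (A k))"
    by (intro suminf_cong) (auto simp: A_def V indicator_def)
  also have "\<dots> \<le> emeasure lborel (ball w (5 / 2 * r))"
    unfolding sum
  proof (rule emeasure_mono)
    show "(\<Union>k. A k) \<subseteq> ball w (5 / 2 * r)"
    proof
      fix x assume "x \<in> (\<Union>k. A k)"
      then obtain k where "dist w (z k) < 2 * r" "dist (z k) x < r / 2"
        by (auto simp: A_def split: if_splits)
      then show "x \<in> ball w (5 / 2 * r)"
        using dist_triangle[of w x "z k"] by simp
    qed
  qed simp
  also have "\<dots> = ennreal (5 ^ DIM(complex ^ 'n)) * V"
  proof -
    have "(5 / 2 * r) ^ DIM(complex ^ 'n) = 5 ^ DIM(complex ^ 'n) * (r / 2) ^ DIM(complex ^ 'n)"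
      by (simp only: power_mult_distrib[symmetric]) simp
    then have "unit_ball_vol (real DIM(complex ^ 'n)) * (5 / 2 * r) ^ DIM(complex ^ 'n)
        = 5 ^ DIM(complex ^ 'n) * (unit_ball_vol (real DIM(complex ^ 'n)) * (r / 2) ^ DIM(complex ^ 'n))"
      by (simp only: mult_ac)
    moreover have "5 / 2 * r \<ge> 0" "r / 2 \<ge> 0"
      using r by auto
    ultimately show ?thesis
      unfolding V_def by (simp only: emeasure_ball) (rule ennreal_mult', simp)
  qed
  finally have "V * (\<Sum>k. indicator ?J k) \<le> V * ennreal (5 ^ DIM(complex ^ 'n))"
    by (simp add: mult.commute)
  then show ?thesis
    using V0 by (subst (asm) ennreal_mult_le_mult_iff) auto
qed

text \<open>
  A ball of radius \<open>r\<close> about \<open>w\<close> is covered by the lattice balls whose centres are at distance less than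
  \<open>2r\<close> from \<open>w\<close>; their number is bounded independently of \<open>w\<close>.
\<close>

lemma averaging_dominated_lattice:
  fixes z :: "nat \<Rightarrow> complex ^ 'n"
  assumes s: "s \<ge> 0" and r: "r > 0" and z: "half_lattice r z"
  shows "dominated (\<lambda>\<mu>. Linf_norm (averaging s r \<mu>)) (\<lambda>\<mu>. linf_norm (\<lambda>k. averaging s r \<mu> (z k)))"
  unfolding dominated_def
proof (intro exI conjI allI impI)
  define C where "C = (1 + 2 * r) powr s * 5 ^ DIM(complex ^ 'n)"
  show "C > 0"
    using r by (simp add: C_def)
  fix \<mu> :: "(complex ^ 'n) measure"
  assume sets: "sets \<mu> = sets borel"
  note [measurable_cong] = sets
  have [measurable]: "ball y r \<in> sets borel" for y :: "complex ^ 'n"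
    by simp
  define L where "L = linf_norm (\<lambda>k. averaging s r \<mu> (z k))"
  have L: "averaging s r \<mu> (z k) \<le> L" for k
    unfolding L_def linf_norm_def by (rule SUP_upper) simp
  have "averaging s r \<mu> w \<le> ennreal C * L" for w
  proof -
    let ?J = "{k. dist w (z k) < 2 * r}"
    have "averaging s r \<mu> w \<le> (\<integral>\<^sup>+x. (\<Sum>k. indicator ?J k * (ennreal ((1 + 2 * r) powr s) *
        (ennreal ((1 + norm (z k)) powr (- s)) * indicator (ball (z k) r) x))) \<partial>\<mu>)"
      unfolding averaging_eq_nn_integral[OF sets]
    proof (rule nn_integral_mono)
      fix x
      define f where "f k = indicator ?J k * (ennreal ((1 + 2 * r) powr s) *
        (ennreal ((1 + norm (z k)) powr (- s)) * indicator (ball (z k) r) x))" for k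
      have f_le: "f k \<le> (\<Sum>k. f k)" for k
        using sum_le_suminf[of f "{k}"] by simp
      have "ennreal ((1 + norm w) powr (- s)) * indicator (ball w r) x \<le> (\<Sum>k. f k)"
      proof (cases "x \<in> ball w r")
        case True
        obtain k where k: "x \<in> ball (z k) r"
          using z unfolding half_lattice_def by blast
        then have d: "dist w (z k) < 2 * r"
          using True dist_triangle[of w "z k" x] by (simp add: dist_commute)
        have "(1 + norm w) powr (- s) \<le> (1 + 2 * r) powr s * (1 + norm (z k)) powr (- s)"
          using d by (intro one_plus_norm_powr_minus_le s) (simp add: dist_commute)
        then have "ennreal ((1 + norm w) powr (- s)) * indicator (ball w r) x \<le> f k"
          using True k d by (simp add: f_def ennreal_mult'[symmetric] ennreal_leI)
        also have "\<dots> \<le> (\<Sum>k. f k)"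
          by (rule f_le)
        finally show ?thesis .
      qed auto
      then show "ennreal ((1 + norm w) powr (- s)) * indicator (ball w r) x
          \<le> (\<Sum>k. indicator ?J k * (ennreal ((1 + 2 * r) powr s) *
              (ennreal ((1 + norm (z k)) powr (- s)) * indicator (ball (z k) r) x)))"
        by (simp only: f_def)
    qed
    also have "\<dots> = (\<Sum>k. \<integral>\<^sup>+x. indicator ?J k * (ennreal ((1 + 2 * r) powr s) *
        (ennreal ((1 + norm (z k)) powr (- s)) * indicator (ball (z k) r) x)) \<partial>\<mu>)"
      by (rule nn_integral_suminf) measurable
    also have "\<dots> = (\<Sum>k. indicator ?J k * (ennreal ((1 + 2 * r) powr s) * averaging s r \<mu> (z k)))"
      unfolding averaging_eq_nn_integral[OF sets]
      by (intro suminf_cong) (simp add: nn_integral_cmult)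
    also have "\<dots> \<le> (\<Sum>k. indicator ?J k * (ennreal ((1 + 2 * r) powr s) * L))"
      by (intro suminf_le mult_left_mono L) auto
    also have "\<dots> = (\<Sum>k. indicator ?J k) * (ennreal ((1 + 2 * r) powr s) * L)"
      by (rule ennreal_suminf_multc)
    also have "\<dots> \<le> ennreal (5 ^ DIM(complex ^ 'n)) * (ennreal ((1 + 2 * r) powr s) * L)"
      by (intro mult_right_mono half_lattice_multiplicity[OF r z]) auto
    also have "\<dots> = ennreal C * L"
      unfolding C_def by (subst ennreal_mult') (auto simp: mult_ac)
    finally show ?thesis .
  qed
  then show "Linf_norm (averaging s r \<mu>) \<le> ennreal C * linf_norm (\<lambda>k. averaging s r \<mu> (z k))"
    unfolding Linf_norm_averaging[OF sets] L_def by (rule SUP_least)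
qed

lemma lattice_dominated_averaging:
  "dominated (\<lambda>\<mu>. linf_norm (\<lambda>k. averaging s r \<mu> (z k))) (\<lambda>\<mu>. Linf_norm (averaging s r \<mu>))"
  unfolding dominated_def linf_norm_def
  by (intro exI[of _ 1]) (auto simp: Linf_norm_averaging intro!: SUP_least SUP_upper)

section \<open>Bounded averages imply the Carleson inequality\<close>

lemma enn_powr_mono: "a > 0 \<Longrightarrow> x \<le> y \<Longrightarrow> enn_powr x a \<le> enn_powr y a"
  by (auto simp: enn_powr_def top_unique intro!: ennreal_leI powr_mono2 enn2real_mono simp: top.not_eq_extremum)

lemma enn_powr_ennreal: "x \<ge> 0 \<Longrightarrow> enn_powr (ennreal x) a = ennreal (x powr a)"
  by (simp add: enn_powr_def)

lemma fs_const_pos: "\<alpha> > 0 \<Longrightarrow> p > 0 \<Longrightarrow> n > 0 \<Longrightarrow> fs_const \<alpha> m p n > 0"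
  unfolding fs_const_def
  by (intro divide_pos_pos mult_pos_pos Gamma_real_pos) (auto intro: add_nonneg_pos)

text \<open>
  Put \<open>X z = (1 + |z|)\<^sup>m\<^sup>p |f z|\<^sup>p exp (- \<alpha>p|z|\<^sup>2/2)\<close> and let \<open>J\<close> be the integral of the density \<open>H\<close> in the
  Fock--Sobolev norm of \<open>f\<close>.  The integrand of the Carleson inequality is
  \<open>(1 + |z|)\<^bsup>-mq\<^esup> X\<^bsup>q/p-1\<^esup> X\<close>.  By the pointwise estimate \<open>X \<le> K J\<close>, which bounds
  \<open>X\<^bsup>q/p-1\<^esup>\<close> (here \<open>q \<ge> p\<close> matters), while the remaining factor \<open>X\<close> is at most \<open>K\<close> times the integral
  of \<open>H\<close> over a ball, to which Fubini's theorem applies.  The total is a multiple of \<open>J\<^bsup>q/p\<^esup>\<close>.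
\<close>

lemma carleson_dominated_averaging:
  assumes \<alpha>: "\<alpha> > 0" and p: "0 < p" and pq: "p \<le> q"
  shows "dominated (\<lambda>\<mu> :: (complex ^ 'n) measure. enn_powr (carleson_norm \<alpha> m p q \<mu>) q)
           (\<lambda>\<mu>. Linf_norm (averaging (real m * q) 5 \<mu>))"
proof -
  have q: "q > 0"
    using p pq by simp
  define s where "s = real m * q"
  have s: "s \<ge> 0"
    using q by (simp add: s_def)
  obtain K where K: "K > 0" and est: "\<And>f a. line_holomorphic (f :: complex ^ 'n \<Rightarrow> complex) \<Longrightarrow>
     ennreal ((1 + norm a) powr (real m * p) * norm (f a) powr p * exp (- (\<alpha> * p / 2) * (norm a)\<^sup>2))
       \<le> ennreal K * (\<integral>\<^sup>+u\<in>ball a 5. ennreal ((norm u ^ m) powr p * norm (f u) powr p *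
                        exp (- (\<alpha> * p / 2) * (norm u)\<^sup>2)) \<partial>lborel)"
    using fock_pointwise_estimate[OF \<alpha> p, where m = m and 'n = 'n] by blast
  define F where "F = fs_const \<alpha> m p CARD('n)"
  have F: "F > 0"
    unfolding F_def using \<alpha> p by (intro fs_const_pos) auto
  define M where "M = K * K powr (q / p - 1) * 6 powr s / F powr (q / p)"
  have M: "M > 0"
    using K F by (simp add: M_def)
  have bound: "carleson_bound \<alpha> m p q \<mu> ((M * S) powr (1 / q))"
    if sets: "sets \<mu> = sets borel" and S: "Linf_norm (averaging s 5 \<mu>) = ennreal S" "S \<ge> 0"
    for \<mu> :: "(complex ^ 'n) measure" and S
    unfolding carleson_bound_def
  proof (intro conjI ballI)
    fix f :: "complex ^ 'n \<Rightarrow> complex"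
    assume "f \<in> fock_sobolev \<alpha> m p"
    then have f: "line_holomorphic f"
      by (intro entire_imp_line_holomorphic) (simp add: fock_sobolev_def)
    note [measurable] = line_holomorphic_measurable[OF f]
    note [measurable_cong] = sets
    define H where "H u = ennreal ((norm u ^ m) powr p * norm (f u) powr p * exp (- (\<alpha> * p / 2) * (norm u)\<^sup>2))" for u
    have [measurable]: "H \<in> borel_measurable borel"
      unfolding H_def by measurable
    note [measurable] = borel_measurable_ball_integral[of H 5]
    define E where "E z = norm (f z) powr q * exp (- (\<alpha> * q / 2) * (norm z)\<^sup>2)" for z
    define X where "X z = (1 + norm z) powr (real m * p) * norm (f z) powr p * exp (- (\<alpha> * p / 2) * (norm z)\<^sup>2)" for z
    have X0: "X z \<ge> 0" for z
      by (simp add: X_def)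
    have avg: "averaging s 5 \<mu> w \<le> ennreal S" for w
      unfolding S(1)[symmetric] Linf_norm_averaging[OF sets] by (rule SUP_upper) simp
    have Xle: "ennreal (X z) \<le> ennreal K * (\<integral>\<^sup>+u\<in>ball z 5. H u \<partial>lborel)" for z
      using est[OF f, of z] by (simp only: X_def H_def)
    have Eq: "E z = (1 + norm z) powr (- s) * (X z powr (q / p - 1) * X z)" for z
    proof -
      have pos: "1 + norm z > 0"
        by (simp add: add_pos_nonneg)
      have "X z powr (q / p) = (1 + norm z) powr s * E z"
        using p by (simp add: X_def E_def s_def powr_mult powr_powr exp_powr_real mult.assoc)
      moreover have "X z powr (q / p) = X z powr (q / p - 1) * X z"
        using powr_add[of "X z" "q / p - 1" 1] X0[of z] by simp
      ultimately show ?thesis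
        using pos by (simp add: powr_minus field_simps)
    qed
    have "(\<integral>\<^sup>+z. ennreal (E z) \<partial>\<mu>) \<le> ennreal (M * S) * enn_powr (fs_norm \<alpha> m p f) q"
    proof (cases "(\<integral>\<^sup>+u. H u \<partial>lborel) = top")
      case False
      then obtain J where J: "(\<integral>\<^sup>+u. H u \<partial>lborel) = ennreal J" "J \<ge> 0"
        by (cases "\<integral>\<^sup>+u. H u \<partial>lborel") auto
      have XJ: "X z \<le> K * J" for z
      proof -
        have "(\<integral>\<^sup>+u\<in>ball z 5. H u \<partial>lborel) \<le> (\<integral>\<^sup>+u. H u \<partial>lborel)"
          by (intro nn_integral_mono) (auto simp: indicator_def)
        then have "ennreal (X z) \<le> ennreal K * ennreal J"
          using Xle[of z] unfolding J(1)[symmetric] by (meson mult_left_mono order_trans zero_le)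
        then show ?thesis
          using K J by (simp add: ennreal_mult'[symmetric])
      qed
      define Q where "Q = (K * J) powr (q / p - 1)"
      have "(\<integral>\<^sup>+z. ennreal (E z) \<partial>\<mu>)
        \<le> (\<integral>\<^sup>+z. ennreal (Q * K) * (ennreal ((1 + norm z) powr (- s)) * (\<integral>\<^sup>+u\<in>ball z 5. H u \<partial>lborel)) \<partial>\<mu>)"
      proof (rule nn_integral_mono)
        fix z
        have "E z \<le> (1 + norm z) powr (- s) * (Q * X z)"
          unfolding Eq Q_def using XJ[of z] X0[of z] p pq
          by (intro mult_left_mono mult_right_mono powr_mono2) auto
        then have "ennreal (E z) \<le> ennreal ((1 + norm z) powr (- s)) * (ennreal Q * ennreal (X z))"
          by (simp add: Q_def X0 ennreal_mult'[symmetric] ennreal_leI)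
        also have "\<dots> \<le> ennreal ((1 + norm z) powr (- s)) * (ennreal Q * (ennreal K * (\<integral>\<^sup>+u\<in>ball z 5. H u \<partial>lborel)))"
          by (intro mult_left_mono Xle) auto
        also have "\<dots> = ennreal (Q * K) * (ennreal ((1 + norm z) powr (- s)) * (\<integral>\<^sup>+u\<in>ball z 5. H u \<partial>lborel))"
        proof -
          have QK: "ennreal (Q * K) = ennreal Q * ennreal K"
            by (rule ennreal_mult') (simp add: Q_def)
          show ?thesis
            unfolding QK by (simp only: mult_ac)
        qed
        finally show "ennreal (E z) \<le> \<dots>" .
      qed
      also have "\<dots> = ennreal (Q * K) * (\<integral>\<^sup>+z. ennreal ((1 + norm z) powr (- s)) * (\<integral>\<^sup>+u\<in>ball z 5. H u \<partial>lborel) \<partial>\<mu>)"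
        by (rule nn_integral_cmult) measurable
      also have "\<dots> \<le> ennreal (Q * K) * (ennreal ((1 + 5) powr s) * ennreal S * (\<integral>\<^sup>+u. H u \<partial>lborel))"
        by (intro mult_left_mono nn_integral_ball_mean_le_averaging sets s avg) auto
      also have "\<dots> = ennreal (Q * K * 6 powr s * S * J)"
        using K J S by (simp add: J(1) Q_def ennreal_mult' mult_ac)
      also have "Q * K * 6 powr s * S * J = M * S * (F * J) powr (q / p)"
      proof -
        have "J powr (q / p) = J powr (q / p - 1) * J"
          using powr_add[of J "q / p - 1" 1] J(2) by simp
        then have FJ: "(F * J) powr (q / p) = F powr (q / p) * (J powr (q / p - 1) * J)"
          by (simp only: powr_mult)
        have KJ: "Q = K powr (q / p - 1) * J powr (q / p - 1)"
          unfolding Q_def by (rule powr_mult)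
        have "F powr (q / p) \<noteq> 0"
          using F by simp
        then show ?thesis
          unfolding FJ KJ M_def by (simp add: nonzero_eq_divide_eq mult_ac)
      qed
      also have "ennreal (M * S * (F * J) powr (q / p)) = ennreal (M * S) * enn_powr (fs_norm \<alpha> m p f) q"
      proof -
        have "fs_norm \<alpha> m p f = ennreal ((F * J) powr (1 / p))"
          using F J unfolding fs_norm_def F_def[symmetric] H_def[symmetric]
          by (simp add: ennreal_mult'[symmetric] enn_powr_ennreal)
        then have "enn_powr (fs_norm \<alpha> m p f) q = ennreal ((F * J) powr (q / p))"
          by (simp add: enn_powr_ennreal powr_powr)
        then show ?thesis
          using M S by (simp add: ennreal_mult')
      qed
      finally show ?thesis .
    next
      \<comment> \<open>With an infinite norm the bound could fail only as \<open>0 \<cdot> \<infinity> = 0\<close>; but vanishing averages force \<open>\<mu> = 0\<close>.\<close>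
      case True
      then have fs: "fs_norm \<alpha> m p f = top"
        using F unfolding fs_norm_def F_def[symmetric] H_def[symmetric] by (simp add: ennreal_mult_top enn_powr_def)
      show ?thesis
      proof (cases "S = 0")
        case False
        then show ?thesis
          using M S by (simp add: fs enn_powr_def ennreal_mult_top)
      next
        case True
        have "averaging s 5 \<mu> w = 0" for w
          using avg[of w] True by simp
        then have "emeasure \<mu> (ball w 5) = 0" for w
          by (simp add: averaging_def divide_ennreal_def add_nonneg_eq_0_iff)
        moreover obtain z :: "nat \<Rightarrow> complex ^ 'n" where "half_lattice 5 z"
          using half_lattice_exists[of 5] by auto
        then have "(\<Union>k. ball (z k) 5) = UNIV"
          by (simp add: half_lattice_def)
        moreover have "range (\<lambda>k. ball (z k) 5) \<subseteq> sets \<mu>"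
          unfolding sets image_subset_iff by simp
        ultimately have "emeasure \<mu> UNIV = 0"
          using emeasure_UN_eq_0[of \<mu> "\<lambda>k. ball (z k) 5"] by simp
        then have "AE z in \<mu>. False"
          by (intro AE_I[of _ _ UNIV]) (auto simp: sets)
        then have "(\<integral>\<^sup>+z. ennreal (E z) \<partial>\<mu>) = (\<integral>\<^sup>+z. 0 \<partial>\<mu>)"
          by (intro nn_integral_cong_AE) (auto elim: eventually_mono)
        then show ?thesis
          by simp
      qed
    qed
    moreover have "((M * S) powr (1 / q)) powr q = M * S"
      using M S q by (simp add: powr_powr)
    ultimately show "(\<integral>\<^sup>+z. ennreal (norm (f z) powr q * exp (- (\<alpha> * q / 2) * (norm z)\<^sup>2)) \<partial>\<mu>)
        \<le> ennreal (((M * S) powr (1 / q)) powr q) * enn_powr (fs_norm \<alpha> m p f) q"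
      by (simp only: E_def)
  qed simp
  show ?thesis
    unfolding dominated_def s_def[symmetric]
  proof (intro exI[of _ M] conjI allI impI M)
    fix \<mu> :: "(complex ^ 'n) measure"
    assume sets: "sets \<mu> = sets borel"
    show "enn_powr (carleson_norm \<alpha> m p q \<mu>) q \<le> ennreal M * Linf_norm (averaging s 5 \<mu>)"
    proof (cases "Linf_norm (averaging s 5 \<mu>)")
      case (real S)
      have "carleson_norm \<alpha> m p q \<mu> \<le> ennreal ((M * S) powr (1 / q))"
        unfolding carleson_norm_def using bound[OF sets real(2,1)] by (intro Inf_lower) auto
      then have "enn_powr (carleson_norm \<alpha> m p q \<mu>) q \<le> enn_powr (ennreal ((M * S) powr (1 / q))) q"
        by (rule enn_powr_mono[OF q])
      also have "\<dots> = ennreal M * ennreal S"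
        using M real q by (simp add: enn_powr_ennreal powr_powr ennreal_mult')
      finally show ?thesis
        by (simp add: real)
    next
      case top
      then show ?thesis
        using M by (simp add: ennreal_mult_top)
    qed
  qed
qed

section \<open>Test functions\<close>

text \<open>
  The normalised reproducing kernel of the Fock space; its modulus times \<open>exp (- \<alpha>|z|\<^sup>2/2)\<close> is the
  Gaussian \<open>exp (- \<alpha>|z - w|\<^sup>2/2)\<close>.
\<close>

definition fock_kernel :: "real \<Rightarrow> complex ^ 'n \<Rightarrow> complex ^ 'n \<Rightarrow> complex" where
  "fock_kernel \<alpha> w z = exp (of_real \<alpha> * hermitian z w + of_real (- (\<alpha> / 2) * (norm w)\<^sup>2))"

lemma norm_fock_kernel_powr:
  "norm (fock_kernel \<alpha> w z) powr p * exp (- (\<alpha> * p / 2) * (norm z)\<^sup>2) = exp (- (\<alpha> * p / 2) * (norm (z - w))\<^sup>2)"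
proof -
  have "norm (fock_kernel \<alpha> w z) powr p = exp ((\<alpha> * Re (hermitian z w) - \<alpha> / 2 * (norm w)\<^sup>2) * p)"
    by (simp add: fock_kernel_def exp_powr_real)
  then have "norm (fock_kernel \<alpha> w z) powr p * exp (- (\<alpha> * p / 2) * (norm z)\<^sup>2)
      = exp ((\<alpha> * Re (hermitian z w) - \<alpha> / 2 * (norm w)\<^sup>2) * p + - (\<alpha> * p / 2) * (norm z)\<^sup>2)"
    by (simp only: exp_add)
  also have "(\<alpha> * Re (hermitian z w) - \<alpha> / 2 * (norm w)\<^sup>2) * p + - (\<alpha> * p / 2) * (norm z)\<^sup>2
      = - (\<alpha> * p / 2) * (norm (z - w))\<^sup>2"
    by (simp add: norm_diff_square_hermitian algebra_simps)
  finally show ?thesis .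
qed

lemma entire_const_mult_fock_kernel: "entire (\<lambda>z. k * fock_kernel \<alpha> w z)"
  unfolding entire_def
proof
  fix z
  obtain D where D: "(fock_kernel \<alpha> w has_derivative D) (at z)" "\<And>c v. D (c *s v) = c * D v"
    using entire_exp_hermitian[of "of_real \<alpha>" w "of_real (- (\<alpha> / 2) * (norm w)\<^sup>2)"]
    unfolding entire_def fock_kernel_def[abs_def] by blast
  then show "\<exists>D. ((\<lambda>z. k * fock_kernel \<alpha> w z) has_derivative D) (at z) \<and> (\<forall>c v. D (c *s v) = c * D v)"
    by (intro exI[of _ "\<lambda>v. k * D v"] conjI has_derivative_mult_right) auto
qed

lemma partial_deriv_fock_kernel:
  "partial_deriv j (\<lambda>z. k * fock_kernel \<alpha> w z) = (\<lambda>z. (k * of_real \<alpha> * cnj (w $ j)) * fock_kernel \<alpha> w z)"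
proof
  fix z
  define A where "A = (\<Sum>i\<in>UNIV - {j}. z $ i * cnj (w $ i))"
  have herm: "hermitian (\<chi> i. if i = j then \<zeta> else z $ i) w = \<zeta> * cnj (w $ j) + A" for \<zeta>
    unfolding hermitian_def A_def by (subst sum.remove[of _ j]) auto
  have z: "(\<chi> i. if i = j then z $ j else z $ i) = z"
    by (simp add: vec_eq_iff)
  have "((\<lambda>\<zeta>. k * exp (of_real \<alpha> * (\<zeta> * cnj (w $ j) + A) + of_real (- (\<alpha> / 2) * (norm w)\<^sup>2))) has_field_derivative
      (k * of_real \<alpha> * cnj (w $ j)) * exp (of_real \<alpha> * (z $ j * cnj (w $ j) + A) + of_real (- (\<alpha> / 2) * (norm w)\<^sup>2))) (at (z $ j))"
    by (auto intro!: derivative_eq_intros)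
  then have "((\<lambda>\<zeta>. k * fock_kernel \<alpha> w (\<chi> i. if i = j then \<zeta> else z $ i)) has_field_derivative
      (k * of_real \<alpha> * cnj (w $ j)) * fock_kernel \<alpha> w (\<chi> i. if i = j then z $ j else z $ i)) (at (z $ j))"
    by (simp only: fock_kernel_def herm)
  then show "partial_deriv j (\<lambda>z. k * fock_kernel \<alpha> w z) z = (k * of_real \<alpha> * cnj (w $ j)) * fock_kernel \<alpha> w z"
    unfolding partial_deriv_def z by (rule DERIV_imp_deriv)
qed

text \<open>
  Partial derivatives of an exponential of a linear form are multiples of it, so membership in the
  Fock--Sobolev space reduces to the finiteness of a Gaussian integral.
\<close>

lemma multi_deriv_fock_kernel:
  "\<exists>k'. multi_deriv \<beta> (\<lambda>z. k * fock_kernel \<alpha> w z) = (\<lambda>z. k' * fock_kernel \<alpha> w z)"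
proof -
  have pow: "\<exists>k'. (partial_deriv j ^^ N) (\<lambda>z. k * fock_kernel \<alpha> w z) = (\<lambda>z. k' * fock_kernel \<alpha> w z)" for j N k
    by (induction N) (auto simp: partial_deriv_fock_kernel)
  have "\<exists>k'. foldr (\<lambda>j. partial_deriv j ^^ \<beta> j) js (\<lambda>z. k * fock_kernel \<alpha> w z) = (\<lambda>z. k' * fock_kernel \<alpha> w z)" for js
  proof (induction js)
    case (Cons j js)
    then obtain k' where "foldr (\<lambda>j. partial_deriv j ^^ \<beta> j) js (\<lambda>z. k * fock_kernel \<alpha> w z) = (\<lambda>z. k' * fock_kernel \<alpha> w z)"
      by blast
    then show ?case
      using pow[where j = j and N = "\<beta> j" and k = k'] by simp
  qed auto
  then show ?thesis
    unfolding multi_deriv_def .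
qed

lemma fock_kernel_mem_fock_sobolev:
  fixes w :: "complex ^ 'n"
  assumes \<alpha>: "\<alpha> > 0" and p: "p > 0"
  shows "(\<lambda>z. k * fock_kernel \<alpha> w z) \<in> fock_sobolev \<alpha> m p"
proof -
  have fin: "fock_norm \<alpha> p (\<lambda>z. k * fock_kernel \<alpha> w z) < top" for k
  proof -
    define c where "c = \<alpha> * p / 2"
    have c: "c > 0"
      using \<alpha> p by (simp add: c_def)
    have "(\<integral>\<^sup>+z. ennreal (norm (k * fock_kernel \<alpha> w z) powr p * exp (- c * (norm z)\<^sup>2)) \<partial>lborel)
        = (\<integral>\<^sup>+z. ennreal (norm k powr p) * ennreal (exp (- c * (norm (z - w))\<^sup>2)) \<partial>lborel)"
      using norm_fock_kernel_powr[of \<alpha> w _ p]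
      by (intro nn_integral_cong) (simp add: norm_mult powr_mult mult.assoc c_def ennreal_mult')
    also have "\<dots> = ennreal (norm k powr p) * (\<integral>\<^sup>+z. ennreal (exp (- c * (norm (z - w))\<^sup>2)) \<partial>lborel)"
      by (rule nn_integral_cmult) measurable
    also have "\<dots> = ennreal (norm k powr p) * (\<integral>\<^sup>+z. ennreal (exp (- c * (norm (z :: complex ^ 'n))\<^sup>2)) \<partial>lborel)"
      by (subst nn_integral_lborel_shift[of "\<lambda>z. ennreal (exp (- c * (norm z)\<^sup>2))" w]) auto
    also have "\<dots> < top"
      using nn_integral_gaussian_finite[OF c, where 'a = "complex ^ 'n"] by (simp add: ennreal_mult_less_top)
    finally show ?thesis
      unfolding fock_norm_def c_def
      by (auto simp: enn_powr_def ennreal_mult_eq_top_iff less_top[symmetric])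
  qed
  have "fock_norm \<alpha> p (multi_deriv \<beta> (\<lambda>z. k * fock_kernel \<alpha> w z)) < top" for \<beta>
    using multi_deriv_fock_kernel[of \<beta> k \<alpha> w] fin by auto
  then have "(\<Sum>\<beta>\<in>I. fock_norm \<alpha> p (multi_deriv \<beta> (\<lambda>z. k * fock_kernel \<alpha> w z))) < top" for I
    by (induction I rule: infinite_finite_induct) auto
  then show ?thesis
    by (simp add: fock_sobolev_def entire_const_mult_fock_kernel)
qed

text \<open>
  Test the Carleson inequality on \<open>f w = (1 + |w|)\<^bsup>-m\<^esup> k\<^sub>w\<close>, with \<open>k\<^sub>w\<close> the normalised kernel at \<open>w\<close>.
  Since \<open>|z|\<^sup>m \<le> (1 + |z - w|)\<^sup>m (1 + |w|)\<^sup>m\<close>, the norm of \<open>f w\<close> is bounded by a Gaussian moment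
  independent of \<open>w\<close>; on the unit ball about \<open>w\<close> the integrand on the left is at least a multiple of
  \<open>(1 + |w|)\<^bsup>-mq\<^esup>\<close>.
\<close>

lemma averaging_dominated_carleson:
  assumes \<alpha>: "\<alpha> > 0" and p: "0 < p" and pq: "p \<le> q"
  shows "dominated (\<lambda>\<mu> :: (complex ^ 'n) measure. Linf_norm (averaging (real m * q) 1 \<mu>))
           (\<lambda>\<mu>. enn_powr (carleson_norm \<alpha> m p q \<mu>) q)"
proof -
  have q: "q > 0"
    using p pq by simp
  define s where "s = real m * q"
  define c where "c = \<alpha> * p / 2"
  have c: "c > 0"
    using \<alpha> p by (simp add: c_def)
  define h where "h v = ennreal ((1 + norm v) powr (real m * p) * exp (- c * (norm v)\<^sup>2))" for v :: "complex ^ 'n"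
  have [measurable]: "h \<in> borel_measurable borel"
    unfolding h_def by measurable
  obtain G where G: "(\<integral>\<^sup>+v. h v \<partial>lborel) = ennreal G" "G \<ge> 0"
    using nn_integral_gaussian_moment_finite[OF c, of "real m * p", where 'a = "complex ^ 'n"] p
    unfolding h_def[symmetric] by (cases "\<integral>\<^sup>+v. h v \<partial>lborel") auto
  define F where "F = fs_const \<alpha> m p CARD('n)"
  have F: "F > 0"
    unfolding F_def using \<alpha> p by (intro fs_const_pos) auto
  define f where "f w z = of_real ((1 + norm w) powr (- real m)) * fock_kernel \<alpha> w z" for w z :: "complex ^ 'n"
  have norm_f: "norm (f w z) powr r * exp (- (\<alpha> * r / 2) * (norm z)\<^sup>2)
      = (1 + norm w) powr (- real m * r) * exp (- (\<alpha> * r / 2) * (norm (z - w))\<^sup>2)" for w z r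
    using norm_fock_kernel_powr[of \<alpha> w z r]
    by (simp add: f_def norm_mult powr_mult powr_powr mult.assoc)
  have fs: "enn_powr (fs_norm \<alpha> m p (f w)) q \<le> ennreal ((F * G) powr (q / p))" for w
  proof -
    have "(\<integral>\<^sup>+z. ennreal ((norm z ^ m) powr p * norm (f w z) powr p * exp (- (\<alpha> * p / 2) * (norm z)\<^sup>2)) \<partial>lborel)
        \<le> (\<integral>\<^sup>+z. h (z - w) \<partial>lborel)"
    proof (rule nn_integral_mono)
      fix z :: "complex ^ 'n"
      have pos: "1 + norm w > 0"
        by (simp add: add_pos_nonneg)
      have pz: "1 + norm z > 0"
        by (simp add: add_pos_nonneg)
      have "(norm z ^ m) powr p \<le> ((1 + norm z) ^ m) powr p"
        using p by (intro powr_mono2 power_mono) auto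
      also have "\<dots> = (1 + norm z) powr (real m * p)"
        using pz by (simp add: powr_realpow[symmetric] powr_powr)
      also have "\<dots> \<le> ((1 + norm (z - w)) * (1 + norm w)) powr (real m * p)"
        using one_plus_norm_le[of z w] p pz by (intro powr_mono2) (auto simp: dist_norm)
      also have "\<dots> = (1 + norm (z - w)) powr (real m * p) * (1 + norm w) powr (real m * p)"
        by (simp add: powr_mult)
      finally have "(norm z ^ m) powr p * ((1 + norm w) powr (- real m * p) * exp (- (\<alpha> * p / 2) * (norm (z - w))\<^sup>2))
          \<le> (1 + norm (z - w)) powr (real m * p) * (1 + norm w) powr (real m * p)
             * ((1 + norm w) powr (- real m * p) * exp (- (\<alpha> * p / 2) * (norm (z - w))\<^sup>2))"
        by (rule mult_right_mono) simp
      also have "\<dots> = (1 + norm (z - w)) powr (real m * p) * exp (- c * (norm (z - w))\<^sup>2)"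
        using pos by (simp add: powr_minus c_def)
      finally show "ennreal ((norm z ^ m) powr p * norm (f w z) powr p * exp (- (\<alpha> * p / 2) * (norm z)\<^sup>2)) \<le> h (z - w)"
        unfolding h_def mult.assoc norm_f by (rule ennreal_leI)
    qed
    also have "\<dots> = ennreal G"
      by (simp add: nn_integral_lborel_shift G)
    finally have "fs_norm \<alpha> m p (f w) \<le> enn_powr (ennreal F * ennreal G) (1 / p)"
      unfolding fs_norm_def F_def using p by (intro enn_powr_mono mult_left_mono) auto
    then have "enn_powr (fs_norm \<alpha> m p (f w)) q \<le> enn_powr (enn_powr (ennreal F * ennreal G) (1 / p)) q"
      by (rule enn_powr_mono[OF q])
    also have "\<dots> = ennreal ((F * G) powr (q / p))"
      using F G by (simp add: ennreal_mult'[symmetric] enn_powr_ennreal powr_powr)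
    finally show ?thesis .
  qed
  define P where "P = exp (\<alpha> * q / 2) * (F * G) powr (q / p) + 1"
  have P: "P > 0"
    by (simp add: P_def add_nonneg_pos)
  have le: "Linf_norm (averaging s 1 \<mu>) \<le> ennreal (P * C powr q)"
    if sets: "sets \<mu> = sets borel" and C: "carleson_bound \<alpha> m p q \<mu> C" for \<mu> :: "(complex ^ 'n) measure" and C
    unfolding Linf_norm_averaging[OF sets]
  proof (rule SUP_least)
    fix w
    note [measurable_cong] = sets
    have "f w \<in> fock_sobolev \<alpha> m p"
      unfolding f_def by (rule fock_kernel_mem_fock_sobolev[OF \<alpha> p])
    then have bound: "(\<integral>\<^sup>+z. ennreal (norm (f w z) powr q * exp (- (\<alpha> * q / 2) * (norm z)\<^sup>2)) \<partial>\<mu>)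
        \<le> ennreal (C powr q) * enn_powr (fs_norm \<alpha> m p (f w)) q"
      using C unfolding carleson_bound_def by blast
    have "averaging s 1 \<mu> w
        \<le> (\<integral>\<^sup>+z. ennreal (exp (\<alpha> * q / 2)) * ennreal (norm (f w z) powr q * exp (- (\<alpha> * q / 2) * (norm z)\<^sup>2)) \<partial>\<mu>)"
      unfolding averaging_eq_nn_integral[OF sets]
    proof (rule nn_integral_mono)
      fix z
      have "(1 + norm w) powr (- s) \<le> exp (\<alpha> * q / 2) * ((1 + norm w) powr (- real m * q) * exp (- (\<alpha> * q / 2) * (norm (z - w))\<^sup>2))"
        if "z \<in> ball w 1"
      proof -
        have "(norm (z - w))\<^sup>2 \<le> 1"
          using that by (simp add: dist_norm norm_minus_commute power_le_one)
        then have "(\<alpha> * q / 2) * (norm (z - w))\<^sup>2 \<le> (\<alpha> * q / 2) * 1"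
          using \<alpha> q by (intro mult_left_mono) auto
        then have "1 \<le> exp (\<alpha> * q / 2) * exp (- (\<alpha> * q / 2) * (norm (z - w))\<^sup>2)"
          by (simp add: exp_add[symmetric])
        then have "(1 + norm w) powr (- s) * 1 \<le> (1 + norm w) powr (- s) * (exp (\<alpha> * q / 2) * exp (- (\<alpha> * q / 2) * (norm (z - w))\<^sup>2))"
          by (rule mult_left_mono) simp
        then show ?thesis
          by (simp add: s_def mult_ac)
      qed
      then show "ennreal ((1 + norm w) powr (- s)) * indicator (ball w 1) z
          \<le> ennreal (exp (\<alpha> * q / 2)) * ennreal (norm (f w z) powr q * exp (- (\<alpha> * q / 2) * (norm z)\<^sup>2))"
        unfolding norm_f by (cases "z \<in> ball w 1") (auto simp: ennreal_mult'[symmetric] intro!: ennreal_leI)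
    qed
    also have "\<dots> = ennreal (exp (\<alpha> * q / 2)) * (\<integral>\<^sup>+z. ennreal (norm (f w z) powr q * exp (- (\<alpha> * q / 2) * (norm z)\<^sup>2)) \<partial>\<mu>)"
      unfolding norm_f by (rule nn_integral_cmult) measurable
    also have "\<dots> \<le> ennreal (exp (\<alpha> * q / 2)) * (ennreal (C powr q) * ennreal ((F * G) powr (q / p)))"
      by (intro mult_left_mono order_trans[OF bound] fs) auto
    also have "\<dots> = ennreal (exp (\<alpha> * q / 2) * (F * G) powr (q / p) * C powr q)"
      by (simp add: ennreal_mult'[symmetric] mult_ac)
    also have "\<dots> \<le> ennreal (P * C powr q)"
      by (intro ennreal_leI mult_right_mono) (auto simp: P_def)
    finally show "averaging s 1 \<mu> w \<le> ennreal (P * C powr q)" .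
  qed
  show ?thesis
    unfolding dominated_def s_def[symmetric]
  proof (intro exI[of _ P] conjI allI impI P)
    fix \<mu> :: "(complex ^ 'n) measure"
    assume sets: "sets \<mu> = sets borel"
    show "Linf_norm (averaging s 1 \<mu>) \<le> ennreal P * enn_powr (carleson_norm \<alpha> m p q \<mu>) q"
    proof (cases "\<exists>C. carleson_bound \<alpha> m p q \<mu> C")
      case False
      then have "carleson_norm \<alpha> m p q \<mu> = top"
        by (simp add: carleson_norm_def)
      then show ?thesis
        using P by (simp add: enn_powr_def ennreal_mult_top)
    next
      case True
      then obtain C0 where C0: "Linf_norm (averaging s 1 \<mu>) \<le> ennreal (P * C0 powr q)"
        using le[OF sets] by blast
      then obtain S where S: "Linf_norm (averaging s 1 \<mu>) = ennreal S" "S \<ge> 0"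
        by (cases "Linf_norm (averaging s 1 \<mu>)") (auto simp: top_unique)
      \<comment> \<open>\<open>y\<close> is below every admissible constant, hence below their infimum.\<close>
      define y where "y = (S / P) powr (1 / q)"
      have "ennreal y \<le> carleson_norm \<alpha> m p q \<mu>"
        unfolding carleson_norm_def
      proof (rule Inf_greatest, clarify)
        fix C assume C: "carleson_bound \<alpha> m p q \<mu> C"
        then have "C \<ge> 0"
          by (simp add: carleson_bound_def)
        have "S \<le> P * C powr q"
          using le[OF sets C] P S by simp
        then have "S / P \<le> C powr q"
          using P by (simp add: field_simps)
        then have "y \<le> (C powr q) powr (1 / q)"
          unfolding y_def using S P q by (intro powr_mono2) auto
        then show "ennreal y \<le> ennreal C"
          using q \<open>C \<ge> 0\<close> by (simp add: powr_powr ennreal_leI)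
      qed
      then have "enn_powr (ennreal y) q \<le> enn_powr (carleson_norm \<alpha> m p q \<mu>) q"
        by (rule enn_powr_mono[OF q])
      moreover have "enn_powr (ennreal y) q = ennreal (S / P)"
        using S P q by (simp add: y_def enn_powr_ennreal powr_powr)
      ultimately have "ennreal P * ennreal (S / P) \<le> ennreal P * enn_powr (carleson_norm \<alpha> m p q \<mu>) q"
        by (intro mult_left_mono) auto
      then show ?thesis
        using P S by (simp add: ennreal_mult'[symmetric])
    qed
  qed
qed

section \<open>The characterisation of Fock--Carleson measures\<close>

lemma fock_carleson_iff: "fock_carleson \<alpha> m p q \<mu> \<longleftrightarrow> enn_powr (carleson_norm \<alpha> m p q \<mu>) q < top"
proof
  assume "fock_carleson \<alpha> m p q \<mu>"
  then obtain C where "carleson_bound \<alpha> m p q \<mu> C"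
    unfolding fock_carleson_def by blast
  then have "carleson_norm \<alpha> m p q \<mu> \<le> ennreal C"
    unfolding carleson_norm_def by (intro Inf_lower) auto
  then show "enn_powr (carleson_norm \<alpha> m p q \<mu>) q < top"
    by (auto simp: enn_powr_def top_unique)
next
  assume "enn_powr (carleson_norm \<alpha> m p q \<mu>) q < top"
  then have "carleson_norm \<alpha> m p q \<mu> \<noteq> top"
    by (auto simp: enn_powr_def)
  then show "fock_carleson \<alpha> m p q \<mu>"
    unfolding fock_carleson_def carleson_norm_def by force
qed

theorem theorem2p1:
  fixes \<alpha> p q :: real and m :: nat and \<mu> :: "(complex ^ 'n) measure"
  assumes "\<alpha> > 0" and "0 < p" and "p \<le> q"
    and "sets \<mu> = sets borel"
  shows
    "(fock_carleson \<alpha> m p q \<mu> \<longleftrightarrow> (\<exists>t>0. Linf_norm (berezin \<alpha> t (real m * q) \<mu>) < top)) \<and>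
     (fock_carleson \<alpha> m p q \<mu> \<longleftrightarrow> (\<forall>t>0. Linf_norm (berezin \<alpha> t (real m * q) \<mu>) < top)) \<and>
     (fock_carleson \<alpha> m p q \<mu> \<longleftrightarrow> (\<exists>r>0. Linf_norm (averaging (real m * q) r \<mu>) < top)) \<and>
     (fock_carleson \<alpha> m p q \<mu> \<longleftrightarrow> (\<forall>r>0. Linf_norm (averaging (real m * q) r \<mu>) < top)) \<and>
     (fock_carleson \<alpha> m p q \<mu> \<longleftrightarrow>
        (\<exists>r>0. \<exists>z. half_lattice r z \<and> linf_norm (\<lambda>k. averaging (real m * q) r \<mu> (z k)) < top)) \<and>
     (fock_carleson \<alpha> m p q \<mu> \<longleftrightarrow>
        (\<forall>r>0. \<forall>z. half_lattice r z \<longrightarrow> linf_norm (\<lambda>k. averaging (real m * q) r \<mu> (z k)) < top)) \<and>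
     (\<forall>t>0. comparable
        (\<lambda>\<nu> :: (complex ^ 'n) measure. enn_powr (carleson_norm \<alpha> m p q \<nu>) q)
        (\<lambda>\<nu>. Linf_norm (berezin \<alpha> t (real m * q) \<nu>))) \<and>
     (\<forall>t>0. \<forall>r>0. comparable
        (\<lambda>\<nu> :: (complex ^ 'n) measure. Linf_norm (berezin \<alpha> t (real m * q) \<nu>))
        (\<lambda>\<nu>. Linf_norm (averaging (real m * q) r \<nu>))) \<and>
     (\<forall>r>0. \<forall>z :: nat \<Rightarrow> complex ^ 'n. half_lattice r z \<longrightarrow> comparable
        (\<lambda>\<nu>. Linf_norm (averaging (real m * q) r \<nu>))
        (\<lambda>\<nu>. linf_norm (\<lambda>k. averaging (real m * q) r \<nu> (z k))))"
proof -
  define s where "s = real m * q"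
  have s: "s \<ge> 0"
    using assms by (simp add: s_def)
  define N where "N \<nu> = enn_powr (carleson_norm \<alpha> m p q \<nu>) q" for \<nu> :: "(complex ^ 'n) measure"
  define B where "B t \<nu> = Linf_norm (berezin \<alpha> t s \<nu>)" for t and \<nu> :: "(complex ^ 'n) measure"
  define A where "A r \<nu> = Linf_norm (averaging s r \<nu>)" for r and \<nu> :: "(complex ^ 'n) measure"
  define L where "L r z \<nu> = linf_norm (\<lambda>k. averaging s r \<nu> (z k))" for r z and \<nu> :: "(complex ^ 'n) measure"
  have AB: "dominated (A r) (B t)" if "r > 0" for r t
    using averaging_dominated_berezin[OF s that] by (simp add: A_def[abs_def] B_def[abs_def])
  have BA: "dominated (B t) (A r)" if "t > 0" "r > 0" for r t
    using berezin_dominated_averaging[OF assms(1) that(1) s that(2)] by (simp add: A_def[abs_def] B_def[abs_def])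
  have AA: "dominated (A r) (A r')" if "r > 0" "r' > 0" for r r'
    using dominated_trans[OF AB[of r 1] BA[of 1 r']] that by simp
  have AL: "dominated (A r) (L r z)" if "r > 0" "half_lattice r z" for r z
    using averaging_dominated_lattice[OF s that] by (simp add: A_def[abs_def] L_def[abs_def])
  have LA: "dominated (L r z) (A r)" for r z
    using lattice_dominated_averaging by (simp add: A_def[abs_def] L_def[abs_def])
  have NA: "dominated N (A r)" if "r > 0" for r
    using dominated_trans[OF _ AA[of 5 r]] carleson_dominated_averaging[OF assms(1-3), of m] that
    by (simp add: A_def[abs_def] N_def[abs_def] s_def)
  have AN: "dominated (A r) N" if "r > 0" for r
    using dominated_trans[OF AA[of r 1]] averaging_dominated_carleson[OF assms(1-3), of m] that
    by (simp add: A_def[abs_def] N_def[abs_def] s_def)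
  have NB: "dominated N (B t)" for t
    using dominated_trans[OF NA AB, of 1 t] by simp
  have BN: "dominated (B t) N" if "t > 0" for t
    using dominated_trans[OF BA AN, of t 1] that by simp
  have NL: "dominated N (L r z)" if "r > 0" "half_lattice r z" for r z
    using dominated_trans[OF NA AL] that by blast
  have LN: "dominated (L r z) N" if "r > 0" for r z
    using dominated_trans[OF LA AN] that by blast
  note finite = dominated_finite[OF _ assms(4)]
  have fc: "fock_carleson \<alpha> m p q \<mu> \<longleftrightarrow> N \<mu> < top"
    unfolding N_def by (rule fock_carleson_iff)
  obtain z1 :: "nat \<Rightarrow> complex ^ 'n" where z1: "half_lattice 1 z1"
    using half_lattice_exists[of 1] by auto
  have 1: "(fock_carleson \<alpha> m p q \<mu> \<longleftrightarrow> (\<exists>t>0. B t \<mu> < top)) \<and> (fock_carleson \<alpha> m p q \<mu> \<longleftrightarrow> (\<forall>t>0. B t \<mu> < top))"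
    unfolding fc using finite[OF NB] finite[OF BN] zero_less_one by blast
  have 2: "(fock_carleson \<alpha> m p q \<mu> \<longleftrightarrow> (\<exists>r>0. A r \<mu> < top)) \<and> (fock_carleson \<alpha> m p q \<mu> \<longleftrightarrow> (\<forall>r>0. A r \<mu> < top))"
    unfolding fc using finite[OF NA] finite[OF AN] zero_less_one by blast
  have 3: "(fock_carleson \<alpha> m p q \<mu> \<longleftrightarrow> (\<exists>r>0. \<exists>z. half_lattice r z \<and> L r z \<mu> < top)) \<and>
      (fock_carleson \<alpha> m p q \<mu> \<longleftrightarrow> (\<forall>r>0. \<forall>z. half_lattice r z \<longrightarrow> L r z \<mu> < top))"
    unfolding fc using finite[OF NL] finite[OF LN] zero_less_one z1 by blast
  have 4: "\<forall>t>0. comparable N (B t)" "\<forall>t>0. \<forall>r>0. comparable (B t) (A r)"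
    "\<forall>r>0. \<forall>z. half_lattice r z \<longrightarrow> comparable (A r) (L r z)"
    using NB BN AB BA AL LA by (auto intro: dominated_imp_comparable)
  from 1 2 3 4 show ?thesis
    unfolding N_def[abs_def] B_def[abs_def] A_def[abs_def] L_def[abs_def] s_def by blast
qed

end
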